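(* Let $\mathbb{k}$ be a field, $S=\mathbb{k}[x_1,\ldots,x_n]$, and let $I\subseteq S$ be the ideal generated by all square-free monomials of degree two. For an integer $k\ge1$ let $\beta_i^{(k)}=\beta_i(S/I^k)$. Then $$\beta_1^{(k)}=\binom{n+2k-1}{n-1}-n\binom{n+k-2}{n-1},$$ and $$\begin{bmatrix}\beta_2^{(k)}\\ \vdots\\ \beta_n^{(k)}\end{bmatrix}=\left[\binom{j}{i}\right]_{\substack{0\le i\le n-2\\ 0\le j\le n-2}}\left[\beta_1^{(k)}-\binom{2k+i}{i}\right]_{0\le i\le n-2}.$$
   Context: For a homogeneous ideal $J\subset S$ (standard grading), the Betti numbers $\beta_i(S/J)$ are the ranks of the free modules in a minimal graded free resolution $0\to S^{\beta_n}\to\cdots\to S^{\beta_1}\to S\to S/J\to 0$. Convention: $\binom{j}{i}=0$ when $i>j$. $[c_{ij}]$ denotes the matrix with entry $c_{ij}$ in row $i$, column $j$, and $[c_i]$ denotes a column vector. *)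

theory Defs
  imports "HOL-Library.Poly_Mapping" "HOL-Library.Cardinality" "Jordan_Normal_Form.Matrix_Kernel"
begin

text \<open>
  The polynomial ring over \<^typ>\<open>'k\<close> with one variable for each element of the finite type
  \<^typ>\<open>'n\<close>; exponent vectors and polynomials are finitely supported functions.
\<close>

type_synonym ('n, 'k) mpoly = "('n \<Rightarrow>\<^sub>0 nat) \<Rightarrow>\<^sub>0 'k"

definition Var :: "'n \<Rightarrow> ('n, 'k::comm_ring_1) mpoly"
  where "Var x = Poly_Mapping.single (Poly_Mapping.single x 1) 1"

definition mdeg :: "('n::finite \<Rightarrow>\<^sub>0 nat) \<Rightarrow> nat"
  where "mdeg t = (\<Sum>x\<in>UNIV. Poly_Mapping.lookup t x)"

definition homogeneous :: "int \<Rightarrow> ('n::finite, 'k::comm_ring_1) mpoly \<Rightarrow> bool"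
  where "homogeneous e f \<longleftrightarrow> (\<forall>t\<in>Poly_Mapping.keys f. int (mdeg t) = e)"

(* A commutative ring regarded as a module over itself: its submodules are its ideals. *)
definition ideal_gen :: "'a::comm_ring_1 set \<Rightarrow> 'a set"
  where "ideal_gen B = Modules.module.span (*) B"

definition ideal_power :: "'a::comm_ring_1 set \<Rightarrow> nat \<Rightarrow> 'a set"
  where "ideal_power I k = ideal_gen {\<Prod>j<k. f j | f. \<forall>j<k. f j \<in> I}"

definition maximal_homogeneous_ideal :: "('n::finite, 'k::comm_ring_1) mpoly set"
  where "maximal_homogeneous_ideal = ideal_gen (range Var)"

definition squarefree_deg2_ideal :: "('n::finite, 'k::comm_ring_1) mpoly set"
  where "squarefree_deg2_ideal =
    ideal_gen {Poly_Mapping.single t 1 | t. (\<forall>x. Poly_Mapping.lookup t x \<le> 1) \<and> mdeg t = 2}"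

definition mat_image :: "'a::comm_ring_1 mat \<Rightarrow> 'a vec set"
  where "mat_image A = {A *\<^sub>v v | v. v \<in> carrier_vec (dim_col A)}"

text \<open>
  A minimal graded free resolution of \<open>S/J\<close>, for a proper homogeneous ideal \<open>J\<close> of the polynomial
  ring \<open>S\<close> in \<open>n\<close> variables,
  \[ 0 \to F_n \to \cdots \to F_1 \to F_0 = S \to S/J \to 0. \]
  Here \<open>F_i\<close> has a homogeneous basis with \<open>r i\<close> elements, the \<open>p\<close>-th one of degree \<open>a i p\<close>, and
  \<open>d i\<close> (used for \<open>i \<ge> 1\<close> only) is the matrix of the map from \<open>F_i\<close> to \<open>F_{i-1}\<close>
  in these bases. The map from \<open>S\<close> to \<open>S/J\<close> is the projection, so exactness at \<open>F_0\<close> says that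
  the image of \<open>d 1\<close> is \<open>J\<close>. Minimality is \<open>d i F_i \<subseteq> (x_1, ..., x_n) F_{i-1}\<close>, stated on matrix
  entries. Exactness at \<open>F_n\<close>, where \<open>r (n + 1) = 0\<close>, is injectivity of \<open>d n\<close>.
\<close>

definition minimal_graded_free_resolution ::
    "('n::finite, 'k::field) mpoly set \<Rightarrow> (nat \<Rightarrow> nat) \<Rightarrow> (nat \<Rightarrow> nat \<Rightarrow> int)
      \<Rightarrow> (nat \<Rightarrow> ('n, 'k) mpoly mat) \<Rightarrow> bool"
  where "minimal_graded_free_resolution J r a d \<longleftrightarrow>
    r 0 = 1 \<and> a 0 0 = 0 \<and> (\<forall>i>CARD('n). r i = 0) \<and>
    (\<forall>i. d (Suc i) \<in> carrier_mat (r i) (r (Suc i))) \<and>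
    (\<forall>i. \<forall>p<r i. \<forall>q<r (Suc i).
       homogeneous (a (Suc i) q - a i p) (d (Suc i) $$ (p, q)) \<and>
       d (Suc i) $$ (p, q) \<in> maximal_homogeneous_ideal) \<and>
    mat_image (d 1) = {vec 1 (\<lambda>_. f) | f. f \<in> J} \<and>
    (\<forall>i. mat_kernel (d (Suc i)) = mat_image (d (Suc (Suc i))))"

text \<open>
  The Betti numbers of \<open>S/J\<close>; meaningful for proper homogeneous ideals \<open>J\<close>, where a minimal graded
  free resolution exists and its ranks are uniquely determined.
\<close>

definition betti :: "('n::finite, 'k::field) mpoly set \<Rightarrow> nat \<Rightarrow> nat"
  where "betti J i = (THE b. \<exists>r a d. minimal_graded_free_resolution J r a d \<and> r i = b)"

end

(*
  The ideal I^k is generated by the monomials of degree 2k all of whose exponents are at most k.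
  In decreasing lexicographic order these generators have linear quotients: the colon ideal of the
  earlier generators by t is generated by a set of q(t) variables, whose quotient is resolved by the
  Koszul complex. Iterated mapping cones give a linear, hence minimal, resolution of S/I^k with
  i-th rank the sum over t of binomial(q(t), i - 1) for i > 0. Ranks of minimal resolutions are
  unique, because the composite of comparison maps in both directions is homotopic to the identity
  and so becomes the identity modulo the variables. It remains to count: binomial(2k + j, j)
  generators have q(t) <= j when j <= n - 2, and binomial(q, i + 1) is the sum of binomial(j, i) over j < q.
*)
theory Submission
  imports Defs
begin

section \<open>Complexes of matrices\<close>

text \<open>\<open>betti\<close> is a definite description, so a minimal resolution must be
  exhibited and its ranks compared with those of any other. The comparison is a pair of
  inequalities, each from the fact that over a field a matrix with a right inverse has at least as
  many columns as rows. A mapping cone could lose minimality through a unit entry of the comparison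
  map. Degrees exclude this: for i > 0 the resolution of the earlier generators has its i-th basis
  in degree 2k + i - 1, while the Koszul complex, shifted by the degree 2k of the new generator, has
  it in degree 2k + i. The comparison map can therefore be cut down to its linear part. The number
  binomial(2k + j, j) counts all monomials of degree 2k in j + 1 variables. The generators with q(t)
  <= j are matched with these, although no generator has an exponent above k and some of them
  involve one more variable: an exponent above k passes its excess to the next variable.\<close>

lemma mat_image_iff:
  assumes "A \<in> carrier_mat m n"
  shows "v \<in> mat_image A \<longleftrightarrow> (\<exists>w\<in>carrier_vec n. v = A *\<^sub>v w)"
  using assms by (auto simp: mat_image_def)

lemma mat_image_mult_subset:
  assumes "A \<in> carrier_mat m n" "B \<in> carrier_mat n l"
  shows "mat_image (A * B) \<subseteq> mat_image A"
proof
  fix v assume "v \<in> mat_image (A * B)"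
  then obtain w where w: "w \<in> carrier_vec l" "v = A * B *\<^sub>v w"
    using assms mat_image_iff[of "A * B" m l] by auto
  then have "v = A *\<^sub>v (B *\<^sub>v w)" using assms by auto
  moreover have "B *\<^sub>v w \<in> carrier_vec n" using assms w by auto
  ultimately show "v \<in> mat_image A" using mat_image_iff[OF assms(1)] by blast
qed

lemma mat_mult_unit_vec:
  fixes A :: "'a::semiring_1 mat"
  assumes A: "A \<in> carrier_mat m n" and j: "j < n"
  shows "A *\<^sub>v unit_vec n j = col A j"
  using col_mult2[OF A one_carrier_mat j] A j by simp

text \<open>Freeness of the source: each column of \<open>A\<close> is the image of a unit vector,
  so it has a preimage under \<open>B\<close>, and these preimages form the columns of
  \<open>X\<close>.\<close>

lemma mat_factor:
  assumes A: "A \<in> carrier_mat m n" and B: "B \<in> carrier_mat m l"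
    and sub: "mat_image A \<subseteq> mat_image B"
  obtains X where "X \<in> carrier_mat l n" "A = B * X"
proof -
  have "\<exists>w\<in>carrier_vec l. col A j = B *\<^sub>v w" if j: "j < n" for j
  proof -
    have "A *\<^sub>v unit_vec n j \<in> mat_image A" using A mat_image_iff[OF A] by auto
    moreover have "A *\<^sub>v unit_vec n j = col A j"
      using mat_mult_unit_vec[OF A j] .
    ultimately show ?thesis using sub mat_image_iff[OF B] by auto
  qed
  then obtain w where w: "\<And>j. j < n \<Longrightarrow> w j \<in> carrier_vec l \<and> col A j = B *\<^sub>v w j" by metis
  define X where "X = mat l n (\<lambda>(i, j). w j $ i)"
  have X: "X \<in> carrier_mat l n" by (simp add: X_def)
  have "A = B * X"
  proof (rule mat_col_eqI)
    fix j assume "j < dim_col (B * X)"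
    then have j: "j < n" using X by auto
    have "col X j = w j" using w[OF j] j by (auto simp: X_def intro!: eq_vecI)
    then show "col A j = col (B * X) j" using w[OF j] j col_mult2[OF B X j] by simp
  qed (use A B X in auto)
  with X show ?thesis using that by blast
qed

text \<open>The common core of minimal and linear resolutions, over any commutative ring; comparison
  maps and homotopies are built for this notion.\<close>

definition resolves :: "'a::comm_ring_1 set \<Rightarrow> (nat \<Rightarrow> nat) \<Rightarrow> (nat \<Rightarrow> 'a mat) \<Rightarrow> bool"
  where "resolves J r d \<longleftrightarrow> r 0 = 1 \<and> (\<forall>i. d (Suc i) \<in> carrier_mat (r i) (r (Suc i))) \<and>
    mat_image (d 1) = {vec 1 (\<lambda>_. f) | f. f \<in> J} \<and>
    (\<forall>i. mat_kernel (d (Suc i)) = mat_image (d (Suc (Suc i))))"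

lemma resolves_carrier: "resolves J r d \<Longrightarrow> d (Suc i) \<in> carrier_mat (r i) (r (Suc i))"
  by (simp add: resolves_def)

lemma resolves_comp_zero:
  assumes "resolves J r d"
  shows "d (Suc i) * d (Suc (Suc i)) = 0\<^sub>m (r i) (r (Suc (Suc i)))"
proof (rule mat_col_eqI)
  note c = resolves_carrier[OF assms]
  fix j assume "j < dim_col (0\<^sub>m (r i) (r (Suc (Suc i))) :: 'a mat)"
  then have j: "j < r (Suc (Suc i))" by simp
  have "col (d (Suc (Suc i))) j = d (Suc (Suc i)) *\<^sub>v unit_vec (r (Suc (Suc i))) j"
    using mat_mult_unit_vec[OF c j] by simp
  then have "col (d (Suc (Suc i))) j \<in> mat_kernel (d (Suc i))"
    using assms mat_image_iff[OF c] unfolding resolves_def by auto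
  then show "col (d (Suc i) * d (Suc (Suc i))) j = col (0\<^sub>m (r i) (r (Suc (Suc i)))) j"
    using mat_kernelD(2)[OF c[of i]] col_mult2[OF c c j] j by simp
qed (use resolves_carrier[OF assms] in auto)

text \<open>Exactness as a lifting property: the columns of \<open>A\<close> are cycles, so the
  image of \<open>A\<close> lies in the image of the next differential and \<open>mat_factor\<close>
  applies.\<close>

lemma resolves_exact:
  assumes "resolves J r d" "A \<in> carrier_mat (r (Suc i)) m" "d (Suc i) * A = 0\<^sub>m (r i) m"
  obtains X where "X \<in> carrier_mat (r (Suc (Suc i))) m" "A = d (Suc (Suc i)) * X"
proof -
  note c = resolves_carrier[OF assms(1)]
  have "mat_image A \<subseteq> mat_image (d (Suc (Suc i)))"
  proof
    fix v assume "v \<in> mat_image A"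
    then obtain w where w: "w \<in> carrier_vec m" "v = A *\<^sub>v w" using mat_image_iff[OF assms(2)] by auto
    have "d (Suc i) *\<^sub>v v = (d (Suc i) * A) *\<^sub>v w"
      using w assms(2) c[of i] by auto
    then have "d (Suc i) *\<^sub>v v = 0\<^sub>v (r i)" using assms(3) w by auto
    then have "v \<in> mat_kernel (d (Suc i))"
      using w assms(2) by (intro mat_kernelI[OF c]) auto
    then show "v \<in> mat_image (d (Suc (Suc i)))" using assms(1) by (simp add: resolves_def)
  qed
  then show ?thesis using mat_factor[OF assms(2) c] that by metis
qed

section \<open>Comparison maps, homotopies and the uniqueness of ranks\<close>

lemma one_smult_mat: "(1::'a::semiring_1) \<cdot>\<^sub>m A = A"
  by (rule eq_matI) auto

lemma smult_mat_mult_vec: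
  fixes A :: "'a::comm_semiring_0 mat"
  assumes "A \<in> carrier_mat m n" "w \<in> carrier_vec n"
  shows "u \<cdot>\<^sub>m A *\<^sub>v w = u \<cdot>\<^sub>v (A *\<^sub>v w)"
  using assms by (intro eq_vecI) (auto simp: scalar_prod_def sum_distrib_left mult.assoc)

lemma vec1_smult: "u \<cdot>\<^sub>v vec 1 (\<lambda>_. f) = vec 1 (\<lambda>_. u * f)"
  by (auto intro!: eq_vecI)

text \<open>Lifts multiplication by \<open>u\<close> to a chain map. The case \<open>u = 1\<close>
  compares two resolutions of the same quotient; a monomial \<open>u\<close> gives the map whose
  cone is formed later.\<close>

lemma comparison:
  assumes F: "resolves J r d" and G: "resolves J' s e" and sub: "\<And>f. f \<in> J' \<Longrightarrow> u * f \<in> J"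
  obtains \<phi> where "\<phi> 0 = u \<cdot>\<^sub>m 1\<^sub>m 1" "\<And>i. \<phi> i \<in> carrier_mat (r i) (s i)"
    "\<And>i. d (Suc i) * \<phi> (Suc i) = \<phi> i * e (Suc i)"
proof -
  note c = resolves_carrier[OF F] and c' = resolves_carrier[OF G]
  \<comment> \<open>The inclusion of images is the invariant that makes the next lift possible. It
    comes from \<open>sub\<close> at index 0 and from exactness afterwards.\<close>
  define P where "P i X \<longleftrightarrow> X \<in> carrier_mat (r i) (s i) \<and> (i = 0 \<longrightarrow> X = u \<cdot>\<^sub>m 1\<^sub>m 1) \<and>
    mat_image (X * e (Suc i)) \<subseteq> mat_image (d (Suc i))" for i X
  have r0: "r 0 = 1" "s 0 = 1" using F G by (auto simp: resolves_def)
  have "\<exists>\<phi>. \<forall>i. P i (\<phi> i) \<and> d (Suc i) * \<phi> (Suc i) = \<phi> i * e (Suc i)"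
  proof (rule dependent_nat_choice)
    have e1: "e (Suc 0) \<in> carrier_mat 1 (s (Suc 0))" using c'[of 0] r0 by simp
    have 1: "(u \<cdot>\<^sub>m 1\<^sub>m 1) * e (Suc 0) = u \<cdot>\<^sub>m e (Suc 0)"
      using mult_smult_assoc_mat[OF one_carrier_mat e1] e1 by simp
    have "mat_image (u \<cdot>\<^sub>m e (Suc 0)) \<subseteq> mat_image (d (Suc 0))"
    proof
      fix v assume "v \<in> mat_image (u \<cdot>\<^sub>m e (Suc 0))"
      then obtain w where w: "w \<in> carrier_vec (s (Suc 0))" "v = u \<cdot>\<^sub>m e (Suc 0) *\<^sub>v w"
        using mat_image_iff[OF smult_carrier_mat[OF e1]] by auto
      have "e (Suc 0) *\<^sub>v w \<in> mat_image (e 1)" using w(1) mat_image_iff[OF e1] by auto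
      then obtain f where "e (Suc 0) *\<^sub>v w = vec 1 (\<lambda>_. f)" "f \<in> J'"
        using G by (auto simp: resolves_def)
      then have "v = vec 1 (\<lambda>_. u * f)" "u * f \<in> J"
        using w sub vec1_smult[of u f] smult_mat_mult_vec[OF e1 w(1), of u] by auto
      then show "v \<in> mat_image (d (Suc 0))" using F by (auto simp: resolves_def)
    qed
    then show "\<exists>X. P 0 X" unfolding P_def using 1 r0 by (intro exI[of _ "u \<cdot>\<^sub>m 1\<^sub>m 1"]) auto
  next
    fix X i assume X: "P i X"
    have Xc: "X \<in> carrier_mat (r i) (s i)" using X by (simp add: P_def)
    have XE: "X * e (Suc i) \<in> carrier_mat (r i) (s (Suc i))" using Xc c'[of i] by auto
    obtain Y where Y: "Y \<in> carrier_mat (r (Suc i)) (s (Suc i))" "X * e (Suc i) = d (Suc i) * Y"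
      using mat_factor[OF XE c[of i]] X unfolding P_def by metis
    have Z: "d (Suc i) * (Y * e (Suc (Suc i))) = 0\<^sub>m (r i) (s (Suc (Suc i)))"
    proof -
      have "d (Suc i) * (Y * e (Suc (Suc i))) = X * e (Suc i) * e (Suc (Suc i))"
        using Y assoc_mult_mat[OF c Y(1) c'] by simp
      also have "\<dots> = X * (e (Suc i) * e (Suc (Suc i)))" using assoc_mult_mat[OF Xc c' c'] by simp
      finally show ?thesis using resolves_comp_zero[OF G, of i] Xc by simp
    qed
    obtain W where "W \<in> carrier_mat (r (Suc (Suc i))) (s (Suc (Suc i)))"
       "Y * e (Suc (Suc i)) = d (Suc (Suc i)) * W"
      using resolves_exact[OF F _ Z] Y c'[of "Suc i"] by (metis mult_carrier_mat)
    then have "mat_image (Y * e (Suc (Suc i))) \<subseteq> mat_image (d (Suc (Suc i)))"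
      using mat_image_mult_subset[OF c] by simp
    then show "\<exists>Y. P (Suc i) Y \<and> d (Suc i) * Y = X * e (Suc i)"
      using Y unfolding P_def by auto
  qed
  then show ?thesis using that unfolding P_def by metis
qed

text \<open>The difference of \<psi> and the identity vanishes at index 0, so it is null-homotopic:
  \<open>h\<close> starts with the zero map and is continued by exactness.\<close>

lemma homotopy:
  assumes F: "resolves J r d" and \<psi>0: "\<psi> 0 = 1\<^sub>m 1"
    and \<psi>: "\<And>i. \<psi> i \<in> carrier_mat (r i) (r i)"
    and comm: "\<And>i. d (Suc i) * \<psi> (Suc i) = \<psi> i * d (Suc i)"
  obtains h where "\<And>i. h i \<in> carrier_mat (r (Suc i)) (r i)"
    "\<And>i. \<psi> (Suc i) = 1\<^sub>m (r (Suc i)) + h i * d (Suc i) + d (Suc (Suc i)) * h (Suc i)"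
proof -
  note c = resolves_carrier[OF F]
  have r0: "r 0 = 1" using F by (auto simp: resolves_def)
  \<comment> \<open>This equation says that \<open>\<psi> (Suc i) - 1 - X * d (Suc i)\<close> maps
    into the kernel of \<open>d (Suc i)\<close>, which is what the next lift requires.\<close>
  define P where "P i X \<longleftrightarrow> X \<in> carrier_mat (r (Suc i)) (r i) \<and>
    d (Suc i) * (X * d (Suc i)) = (\<psi> i - 1\<^sub>m (r i)) * d (Suc i)" for i X
  have "\<exists>h. \<forall>i. P i (h i) \<and> \<psi> (Suc i) - 1\<^sub>m (r (Suc i)) - h i * d (Suc i) = d (Suc (Suc i)) * h (Suc i)"
  proof (rule dependent_nat_choice)
    have "d (Suc 0) * (0\<^sub>m (r (Suc 0)) (r 0) * d (Suc 0)) = 0\<^sub>m (r 0) (r (Suc 0))"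
      using c[of 0] by simp
    moreover have "\<psi> 0 - 1\<^sub>m (r 0) = 0\<^sub>m (r 0) (r 0)" using \<psi>0 r0 by auto
    ultimately show "\<exists>X. P 0 X" unfolding P_def using c[of 0]
      by (intro exI[of _ "0\<^sub>m (r (Suc 0)) (r 0)"]) auto
  next
    fix X i assume X: "P i X"
    let ?d = "d (Suc i)" and ?e = "d (Suc (Suc i))" and ?I = "1\<^sub>m (r (Suc i)) :: 'a mat"
    have Xc: "X \<in> carrier_mat (r (Suc i)) (r i)" using X by (simp add: P_def)
    have Xd: "X * ?d \<in> carrier_mat (r (Suc i)) (r (Suc i))" using Xc c[of i] by auto
    have A: "\<psi> (Suc i) - ?I \<in> carrier_mat (r (Suc i)) (r (Suc i))" using \<psi>[of "Suc i"] by auto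
    have "?d * (\<psi> (Suc i) - ?I - X * ?d) = ?d * \<psi> (Suc i) - ?d * ?I - ?d * (X * ?d)"
      using mult_minus_distrib_mat[OF c A Xd] mult_minus_distrib_mat[OF c \<psi> one_carrier_mat] by simp
    also have "?d * \<psi> (Suc i) - ?d * ?I = (\<psi> i - 1\<^sub>m (r i)) * ?d"
      using minus_mult_distrib_mat[OF \<psi> one_carrier_mat c] comm c[of i] by simp
    also have "\<dots> - ?d * (X * ?d) = 0\<^sub>m (r i) (r (Suc i))"
      using X c[of i] \<psi>[of i] unfolding P_def by (metis minus_carrier_mat minus_r_inv_mat mult_carrier_mat one_carrier_mat)
    finally have Z: "?d * (\<psi> (Suc i) - ?I - X * ?d) = 0\<^sub>m (r i) (r (Suc i))" .
    obtain Y where Y: "Y \<in> carrier_mat (r (Suc (Suc i))) (r (Suc i))"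
       "\<psi> (Suc i) - ?I - X * ?d = ?e * Y"
      using resolves_exact[OF F _ Z] A Xd by (metis minus_carrier_mat)
    have "?e * (Y * ?e) = (\<psi> (Suc i) - ?I - X * ?d) * ?e"
      using Y c[of "Suc i"] assoc_mult_mat[OF c Y(1) c] by simp
    also have "\<dots> = (\<psi> (Suc i) - ?I) * ?e - X * ?d * ?e"
      using minus_mult_distrib_mat[OF A Xd c] by simp
    also have "X * ?d * ?e = 0\<^sub>m (r (Suc i)) (r (Suc (Suc i)))"
      using assoc_mult_mat[OF Xc c c] resolves_comp_zero[OF F, of i] Xc by simp
    finally have "P (Suc i) Y" unfolding P_def using Y A c[of "Suc i"] by auto
    then show "\<exists>Y. P (Suc i) Y \<and> \<psi> (Suc i) - ?I - X * ?d = ?e * Y" using Y by auto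
  qed
  then obtain h where h: "\<And>i. P i (h i)"
    "\<And>i. \<psi> (Suc i) - 1\<^sub>m (r (Suc i)) - h i * d (Suc i) = d (Suc (Suc i)) * h (Suc i)" by metis
  show ?thesis
  proof
    show hc: "h i \<in> carrier_mat (r (Suc i)) (r i)" for i using h(1)[of i] by (simp add: P_def)
    show "\<psi> (Suc i) = 1\<^sub>m (r (Suc i)) + h i * d (Suc i) + d (Suc (Suc i)) * h (Suc i)" for i
      unfolding h(2)[symmetric] using \<psi>[of "Suc i"] hc[of i] c[of i]
      by (intro eq_matI) auto
  qed
qed

text \<open>If \<open>n < m\<close>, padding \<open>A\<close> with zero columns and \<open>B\<close>
  with zero rows gives square matrices with product 1. The product in the other order is then 1 as
  well, yet it has a zero row.\<close>

lemma right_inverse_dim_le: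
  fixes A :: "'a::field mat"
  assumes A: "A \<in> carrier_mat m n" and B: "B \<in> carrier_mat n m" and AB: "A * B = 1\<^sub>m m"
  shows "m \<le> n"
proof (rule ccontr)
  assume "\<not> m \<le> n"
  then have lt: "n < m" by simp
  define A' where "A' = mat m m (\<lambda>(i, j). if j < n then A $$ (i, j) else 0)"
  define B' where "B' = mat m m (\<lambda>(i, j). if i < n then B $$ (i, j) else 0)"
  have c: "A' \<in> carrier_mat m m" "B' \<in> carrier_mat m m" by (auto simp: A'_def B'_def)
  have "A' * B' = A * B"
  proof (rule eq_matI)
    fix i j assume "i < dim_row (A * B)" "j < dim_col (A * B)"
    then have ij: "i < m" "j < m" using A B by auto
    have "(A' * B') $$ (i, j) = (\<Sum>l<m. A' $$ (i, l) * B' $$ (l, j))"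
      using c ij by (simp add: scalar_prod_def lessThan_atLeast0)
    also have "\<dots> = (\<Sum>l<n. A $$ (i, l) * B $$ (l, j))"
      using lt ij by (intro sum.mono_neutral_cong_right) (auto simp: A'_def B'_def)
    also have "\<dots> = (A * B) $$ (i, j)"
      using A B ij by (simp add: scalar_prod_def lessThan_atLeast0)
    finally show "(A' * B') $$ (i, j) = (A * B) $$ (i, j)" .
  qed (use A B c in auto)
  then have "B' * A' = 1\<^sub>m m" using mat_mult_left_right_inverse[OF c] AB by simp
  moreover have "(B' * A') $$ (n, n) = 0"
    using lt c by (simp add: scalar_prod_def) (simp add: B'_def)
  ultimately show False using lt by simp
qed

text \<open>Since \<epsilon> kills the entries of \<open>d\<close>, the relation
  \<open>g f = 1 + h d + d h\<close> reduces to the statement that the image of \<open>g\<close>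
  over the field has a right inverse. For two minimal resolutions the inequality holds both
  ways.\<close>

lemma rank_le:
  fixes \<epsilon> :: "'a::comm_ring_1 \<Rightarrow> 'b::field"
  assumes hom: "semiring_hom \<epsilon>"
    and F: "resolves J r d" and G: "resolves J s e"
    and min: "\<And>i p q. p < r i \<Longrightarrow> q < r (Suc i) \<Longrightarrow> \<epsilon> (d (Suc i) $$ (p, q)) = 0"
  shows "r i \<le> s i"
proof -
  interpret semiring_hom \<epsilon> by fact
  note c = resolves_carrier[OF F] and c' = resolves_carrier[OF G]
  have r0: "r 0 = 1" "s 0 = 1" using F G by (auto simp: resolves_def)
  obtain f where f: "f 0 = 1 \<cdot>\<^sub>m 1\<^sub>m 1" "\<And>i. f i \<in> carrier_mat (s i) (r i)"
    "\<And>i. e (Suc i) * f (Suc i) = f i * d (Suc i)"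
    using comparison[OF G F, of 1] by auto
  obtain g where g: "g 0 = 1 \<cdot>\<^sub>m 1\<^sub>m 1" "\<And>i. g i \<in> carrier_mat (r i) (s i)"
    "\<And>i. d (Suc i) * g (Suc i) = g i * e (Suc i)"
    using comparison[OF F G, of 1] by auto
  have comm: "d (Suc i) * (g (Suc i) * f (Suc i)) = (g i * f i) * d (Suc i)" for i
  proof -
    have "d (Suc i) * (g (Suc i) * f (Suc i)) = (g i * e (Suc i)) * f (Suc i)"
      using assoc_mult_mat[OF c g(2) f(2)] g(3) by simp
    also have "\<dots> = g i * (f i * d (Suc i))"
      using assoc_mult_mat[OF g(2) c' f(2)] f(3) by simp
    finally show ?thesis using assoc_mult_mat[OF g(2) f(2) c] by simp
  qed
  have gf: "g i * f i \<in> carrier_mat (r i) (r i)" for i using f(2)[of i] g(2)[of i] by auto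
  have gf0: "g 0 * f 0 = 1\<^sub>m 1" using f(1) g(1) by (simp add: one_smult_mat)
  obtain h where h: "\<And>i. h i \<in> carrier_mat (r (Suc i)) (r i)"
    "\<And>i. g (Suc i) * f (Suc i) = 1\<^sub>m (r (Suc i)) + h i * d (Suc i) + d (Suc (Suc i)) * h (Suc i)"
    using homotopy[OF F, of "\<lambda>i. g i * f i"] gf0 gf comm by metis
  have \<epsilon>d: "map_mat \<epsilon> (d (Suc i)) = 0\<^sub>m (r i) (r (Suc i))" for i
    using min[of _ i] c[of i] by (intro eq_matI) auto
  have "map_mat \<epsilon> (g i * f i) = 1\<^sub>m (r i)"
  proof (cases i)
    case 0
    then show ?thesis using gf0 r0 by (simp add: mat_hom_one)
  next
    case (Suc j)
    have 1: "map_mat \<epsilon> (h j * d (Suc j)) = 0\<^sub>m (r (Suc j)) (r (Suc j))"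
      using mat_hom_mult[OF h(1) c] \<epsilon>d h(1)[of j] by simp
    have 2: "map_mat \<epsilon> (d (Suc (Suc j)) * h (Suc j)) = 0\<^sub>m (r (Suc j)) (r (Suc j))"
      using mat_hom_mult[OF c h(1)] \<epsilon>d h(1)[of "Suc j"] by simp
    have "h j * d (Suc j) \<in> carrier_mat (r (Suc j)) (r (Suc j))"
       "d (Suc (Suc j)) * h (Suc j) \<in> carrier_mat (r (Suc j)) (r (Suc j))"
      using h(1)[of j] c[of j] h(1)[of "Suc j"] c[of "Suc j"] by auto
    moreover have "map_mat \<epsilon> (1\<^sub>m n + X + Y) = 1\<^sub>m n + map_mat \<epsilon> X + map_mat \<epsilon> Y"
      if "X \<in> carrier_mat n n" "Y \<in> carrier_mat n n" for n X Y
      using that by (intro eq_matI) (auto simp: hom_add)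
    ultimately have "map_mat \<epsilon> (g i * f i) = 1\<^sub>m (r i) + map_mat \<epsilon> (h j * d (Suc j)) +
      map_mat \<epsilon> (d (Suc (Suc j)) * h (Suc j))"
      unfolding Suc h(2) by blast
    then show ?thesis using 1 2 Suc by simp
  qed
  then have "map_mat \<epsilon> (g i) * map_mat \<epsilon> (f i) = 1\<^sub>m (r i)"
    using mat_hom_mult[OF g(2) f(2)] by simp
  then show ?thesis using f(2)[of i] g(2)[of i] by (intro right_inverse_dim_le[of "map_mat \<epsilon> (g i)" "r i" "s i" "map_mat \<epsilon> (f i)"]) auto
qed

section \<open>Linear resolutions and mapping cones\<close>

lemma mdeg_add: "mdeg (s + t) = mdeg s + mdeg t"
  by (simp add: mdeg_def lookup_add sum.distrib)

definition homog_comp :: "nat \<Rightarrow> ('n::finite, 'k::comm_ring_1) mpoly \<Rightarrow> ('n, 'k) mpoly"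
  where "homog_comp a f = Poly_Mapping.mapp (\<lambda>t c. c when mdeg t = a) f"

lemma lookup_homog_comp:
  "Poly_Mapping.lookup (homog_comp a f) t = (Poly_Mapping.lookup f t when mdeg t = a)"
  by (auto simp: homog_comp_def lookup_mapp when_def in_keys_iff)

lemma homogeneous_homog_comp: "homogeneous (int a) (homog_comp a f)"
  by (auto simp: homogeneous_def in_keys_iff lookup_homog_comp when_def split: if_splits)

lemma homog_comp_add: "homog_comp a (f + g) = homog_comp a f + homog_comp a g"
  by (rule poly_mapping_eqI) (auto simp: lookup_homog_comp lookup_add when_def)

lemma homog_comp_sum: "homog_comp a (sum f A) = (\<Sum>x\<in>A. homog_comp a (f x))"
proof (induction A rule: infinite_finite_induct)
  case (insert x A)
  then show ?case by (simp add: homog_comp_add)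
qed (auto intro!: poly_mapping_eqI simp: lookup_homog_comp)

lemma homog_comp_homogeneous: "homogeneous (int a) f \<Longrightarrow> homog_comp a f = f"
  by (rule poly_mapping_eqI) (auto simp: lookup_homog_comp homogeneous_def when_def in_keys_iff)

lemma homogeneous_mult:
  "homogeneous a f \<Longrightarrow> homogeneous b g \<Longrightarrow> homogeneous (a + b) (f * g)"
  using keys_mult[of f g] by (fastforce simp: homogeneous_def mdeg_add)

text \<open>Removing from \<open>g\<close> its component of degree \<open>b\<close> leaves terms of
  other degrees, and multiplied by \<open>f\<close> these contribute nothing in degree
  \<open>a + b\<close>.\<close>

lemma homog_comp_mult:
  assumes f: "homogeneous (int a) f"
  shows "homog_comp (a + b) (f * g) = f * homog_comp b g"
proof -
  have "homog_comp (a + b) (f * (g - homog_comp b g)) = 0"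
  proof (rule poly_mapping_eqI)
    fix t
    have "t \<notin> Poly_Mapping.keys (f * (g - homog_comp b g))" if "mdeg t = a + b"
    proof
      assume "t \<in> Poly_Mapping.keys (f * (g - homog_comp b g))"
      then obtain u v where uv: "t = u + v" "u \<in> Poly_Mapping.keys f"
        "v \<in> Poly_Mapping.keys (g - homog_comp b g)" using keys_mult by blast
      then have "mdeg u = a" using f by (auto simp: homogeneous_def)
      then have "mdeg v = b" using uv that by (simp add: mdeg_add)
      then show False using uv(3) by (simp add: in_keys_iff lookup_minus lookup_homog_comp)
    qed
    then show "Poly_Mapping.lookup (homog_comp (a + b) (f * (g - homog_comp b g))) t =
        Poly_Mapping.lookup 0 t"
      by (auto simp: lookup_homog_comp when_def in_keys_iff)
  qed
  moreover have "homog_comp (a + b) (f * homog_comp b g) = f * homog_comp b g"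
    using homogeneous_mult[OF f homogeneous_homog_comp[of b g]]
    by (intro homog_comp_homogeneous) simp
  moreover have "f * g = f * homog_comp b g + f * (g - homog_comp b g)"
    by (simp add: algebra_simps)
  ultimately show ?thesis by (simp add: homog_comp_add)
qed

text \<open>One degree serves for the whole matrix because each free module of a linear resolution
  is generated in a single degree. Zero entries are homogeneous of every degree.\<close>

definition homog_mat :: "nat \<Rightarrow> ('n::finite, 'k::comm_ring_1) mpoly mat \<Rightarrow> bool"
  where "homog_mat a A \<longleftrightarrow> (\<forall>p<dim_row A. \<forall>q<dim_col A. homogeneous (int a) (A $$ (p, q)))"

lemma homog_mat_map: "homog_mat a (map_mat (homog_comp a) A)"
  by (auto simp: homog_mat_def homogeneous_homog_comp)

lemma map_homog_comp_homog_mat: "homog_mat a A \<Longrightarrow> map_mat (homog_comp a) A = A"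
  by (rule eq_matI) (auto simp: homog_mat_def homog_comp_homogeneous)

lemma map_homog_comp_mult_left:
  assumes "A \<in> carrier_mat m n" "B \<in> carrier_mat n l" "homog_mat a A"
  shows "map_mat (homog_comp (a + b)) (A * B) = A * map_mat (homog_comp b) B"
  using assms
  by (intro eq_matI) (auto simp: scalar_prod_def homog_comp_sum homog_comp_mult homog_mat_def)

lemma map_homog_comp_mult_right:
  assumes "A \<in> carrier_mat m n" "B \<in> carrier_mat n l" "homog_mat b B"
  shows "map_mat (homog_comp (a + b)) (A * B) = map_mat (homog_comp a) A * B"
proof -
  have "homog_comp (a + b) (f * g) = homog_comp a f * g" if "homogeneous (int b) g"
    for f g :: "('a, 'b) mpoly"
    using homog_comp_mult[OF that, of a f] by (simp add: mult.commute add.commute)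
  then show ?thesis using assms
    by (intro eq_matI) (auto simp: scalar_prod_def homog_comp_sum homog_mat_def)
qed

text \<open>For i > 0 the i-th free module is generated in degree \<open>\<delta> + i - 1\<close>,
  hence entries of degree \<delta> in \<open>d 1\<close> and of degree 1 beyond. For positive
  \<delta> no entry has a constant term, so minimality is automatic.\<close>

definition linear_resolution ::
    "('n::finite, 'k::comm_ring_1) mpoly set \<Rightarrow> nat \<Rightarrow> (nat \<Rightarrow> nat) \<Rightarrow> (nat \<Rightarrow> ('n, 'k) mpoly mat) \<Rightarrow> bool"
  where "linear_resolution J \<delta> r d \<longleftrightarrow> resolves J r d \<and>
    homog_mat \<delta> (d 1) \<and> (\<forall>i. homog_mat 1 (d (Suc (Suc i))))"

text \<open>Cutting the maps of positive index down to their components of degree 1 keeps a chain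
  map: as \<open>u\<close> and the differentials are homogeneous, this just takes one homogeneous
  component of each commuting square, of degree \<open>\<delta> + 1\<close> for the first square and
  2 for the others.\<close>

lemma linear_comparison:
  assumes F: "linear_resolution J \<delta> r d" and G: "linear_resolution J' 1 s e"
    and u: "homogeneous (int \<delta>) u" and sub: "\<And>f. f \<in> J' \<Longrightarrow> u * f \<in> J"
  obtains \<phi> where "\<phi> 0 = u \<cdot>\<^sub>m 1\<^sub>m 1" "\<And>i. \<phi> i \<in> carrier_mat (r i) (s i)"
    "\<And>i. d (Suc i) * \<phi> (Suc i) = \<phi> i * e (Suc i)" "\<And>i. homog_mat 1 (\<phi> (Suc i))"
proof -
  have FG: "resolves J r d" "resolves J' s e" using F G by (auto simp: linear_resolution_def)
  note c = resolves_carrier[OF FG(1)] and c' = resolves_carrier[OF FG(2)]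
  have e: "homog_mat 1 (e (Suc i))" for i
    using G by (cases i) (auto simp: linear_resolution_def)
  obtain \<phi> where \<phi>: "\<phi> 0 = u \<cdot>\<^sub>m 1\<^sub>m 1" "\<And>i. \<phi> i \<in> carrier_mat (r i) (s i)"
    "\<And>i. d (Suc i) * \<phi> (Suc i) = \<phi> i * e (Suc i)"
    using comparison[OF FG sub] by metis
  define \<psi> where "\<psi> i = (if i = 0 then \<phi> 0 else map_mat (homog_comp 1) (\<phi> i))" for i
  have h0: "homog_mat \<delta> (\<phi> 0)" using u by (auto simp: \<phi>(1) homog_mat_def)
  have "d (Suc i) * \<psi> (Suc i) = \<psi> i * e (Suc i)" for i
  proof (cases i)
    case 0
    have "d (Suc 0) * \<psi> (Suc 0) = map_mat (homog_comp (\<delta> + 1)) (\<phi> 0 * e (Suc 0))"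
      using map_homog_comp_mult_left[OF c[of 0] \<phi>(2), of \<delta> 1] F \<phi>(3)[of 0]
      by (simp add: \<psi>_def linear_resolution_def)
    also have "\<dots> = \<phi> 0 * e (Suc 0)"
      using map_homog_comp_mult_right[OF \<phi>(2) c'[of 0] e, of \<delta>] map_homog_comp_homog_mat[OF h0] by simp
    finally show ?thesis by (simp add: 0 \<psi>_def)
  next
    case (Suc j)
    have "d (Suc i) * \<psi> (Suc i) = map_mat (homog_comp (1 + 1)) (\<phi> i * e (Suc i))"
      using map_homog_comp_mult_left[OF c[of i] \<phi>(2), of 1 1] F \<phi>(3)[of i]
      by (simp add: Suc \<psi>_def linear_resolution_def)
    also have "\<dots> = \<psi> i * e (Suc i)"
      using map_homog_comp_mult_right[OF \<phi>(2) c'[of i] e, of 1] by (simp add: \<psi>_def Suc)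
    finally show ?thesis .
  qed
  moreover have "\<psi> i \<in> carrier_mat (r i) (s i)" for i using \<phi>(2) by (simp add: \<psi>_def)
  ultimately show ?thesis using that[of \<psi>] \<phi>(1) by (simp add: \<psi>_def homog_mat_map)
qed

lemma linear_resolution_zero:
  "linear_resolution {0} \<delta> (\<lambda>i. if i = 0 then 1 else 0)
    (\<lambda>i. 0\<^sub>m (if i = 1 then 1 else 0) 0)"
proof -
  have 1: "mat_kernel (0\<^sub>m m 0 :: ('n::finite, 'k::comm_ring_1) mpoly mat) = {0\<^sub>v 0}" for m
    by (auto simp: mat_kernel_def intro!: eq_vecI)
  have 2: "mat_image (0\<^sub>m m 0 :: ('n::finite, 'k::comm_ring_1) mpoly mat) = {0\<^sub>v m}" for m
    by (auto simp: mat_image_def scalar_prod_def intro!: eq_vecI exI[of _ "0\<^sub>v 0"])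
  show ?thesis
    by (auto simp: linear_resolution_def resolves_def homog_mat_def 1 2 intro!: eq_vecI)
qed

section \<open>Mapping cones of linear resolutions\<close>

lemma vec1_eq_iff: "vec 1 (\<lambda>_. a) = vec 1 (\<lambda>_. b) \<longleftrightarrow> a = b"
proof
  assume "vec 1 (\<lambda>_. a) = vec 1 (\<lambda>_. b)"
  then have "vec 1 (\<lambda>_. a) $ 0 = vec 1 (\<lambda>_. b) $ 0" by (simp only:)
  then show "a = b" by simp
qed simp

lemma mult_mat_uminus_vec:
  fixes A :: "'a::ring mat"
  assumes "A \<in> carrier_mat m n" "v \<in> carrier_vec n"
  shows "A *\<^sub>v (- v) = - (A *\<^sub>v v)"
  using assms by (intro eq_vecI) auto

lemma vec_eq_uminus_if_add_eq_0:
  fixes a b :: "'a::group_add vec"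
  assumes "a \<in> carrier_vec n" "b \<in> carrier_vec n" "a + b = 0\<^sub>v n"
  shows "b = - a"
proof (rule eq_vecI)
  fix i assume "i < dim_vec (- a)"
  then have i: "i < n" using assms(1) by simp
  then have "(a + b) $ i = 0" unfolding assms(3) by simp
  then show "b $ i = (- a) $ i" using assms(1,2) i by (simp add: minus_unique)
qed (use assms in auto)

lemma resolves_comp_zero_vec:
  assumes "resolves J r d" "v \<in> carrier_vec (r (Suc (Suc i)))"
  shows "d (Suc i) *\<^sub>v (d (Suc (Suc i)) *\<^sub>v v) = 0\<^sub>v (r i)"
proof -
  note c = resolves_carrier[OF assms(1)]
  have "d (Suc (Suc i)) *\<^sub>v v \<in> mat_kernel (d (Suc i))"
    using assms mat_image_iff[OF c] by (auto simp: resolves_def)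
  then show ?thesis using mat_kernelD(2)[OF c] by blast
qed

lemma homog_mat_four_block:
  assumes "A \<in> carrier_mat m n" "B \<in> carrier_mat m n'" "C \<in> carrier_mat m' n" "D \<in> carrier_mat m' n'"
    and "homog_mat a A" "homog_mat a B" "homog_mat a C" "homog_mat a D"
  shows "homog_mat a (four_block_mat A B C D)"
  using assms by (auto simp: homog_mat_def)

text \<open>Multiplication by \<open>u\<close> embeds S/(J : u) into S/J with cokernel S/(J + (u)),
  so the cone of its lift resolves the latter. The index shift of the cone and the degree \<delta>
  of \<open>u\<close> put the new basis elements in the degrees of the old ones, so linearity
  persists.\<close>

lemma linear_resolution_cone:
  assumes F: "linear_resolution J \<delta> r d" and G: "linear_resolution {f. u * f \<in> J} 1 s e"
    and u: "homogeneous (int \<delta>) u"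
  obtains D where "linear_resolution {f + u * g | f g. f \<in> J} \<delta>
    (\<lambda>i. r i + (if i = 0 then 0 else s (i - 1))) D"
proof -
  have FG: "resolves J r d" "resolves {f. u * f \<in> J} s e" using F G by (auto simp: linear_resolution_def)
  note c = resolves_carrier[OF FG(1)] and c' = resolves_carrier[OF FG(2)]
  have e: "homog_mat 1 (e (Suc i))" for i
    using G by (cases i) (auto simp: linear_resolution_def)
  have r0: "r 0 = 1" "s 0 = 1" using FG by (auto simp: resolves_def)
  obtain \<phi> where \<phi>: "\<phi> 0 = u \<cdot>\<^sub>m 1\<^sub>m 1" "\<And>i. \<phi> i \<in> carrier_mat (r i) (s i)"
    "\<And>i. d (Suc i) * \<phi> (Suc i) = \<phi> i * e (Suc i)" "\<And>i. homog_mat 1 (\<phi> (Suc i))"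
    using linear_comparison[OF F G u] by auto
  define s' where "s' i = (if i = 0 then 0 else s (i - 1))" for i
  define e' where "e' i = (if i = 0 then 0\<^sub>m 0 1 else - e i)" for i
  have e': "e' i \<in> carrier_mat (s' i) (s' (Suc i))" for i
    using c'[of "i - 1"] r0 by (cases i) (auto simp: e'_def s'_def)
  \<comment> \<open>The sign in \<open>e'\<close> makes consecutive differentials compose to zero.
    As \<open>e' 0\<close> has no rows, the same formula covers \<open>D 1\<close>, which is the row
    \<open>d 1\<close> extended by the entry \<open>u\<close>.\<close>
  define D where "D i = four_block_mat (d i) (\<phi> (i - 1)) (0\<^sub>m (s' (i - 1)) (r i)) (e' (i - 1))" for i
  have \<phi>': "\<phi> i \<in> carrier_mat (r i) (s' (Suc i))" for i using \<phi>(2) by (simp add: s'_def)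
  have Dc: "D (Suc i) \<in> carrier_mat (r i + s' i) (r (Suc i) + s' (Suc i))" for i
    unfolding D_def using four_block_carrier_mat[OF c e'] by simp
  have Dv: "D (Suc i) *\<^sub>v (x @\<^sub>v y) = (d (Suc i) *\<^sub>v x + \<phi> i *\<^sub>v y) @\<^sub>v (e' i *\<^sub>v y)"
    if "x \<in> carrier_vec (r (Suc i))" "y \<in> carrier_vec (s' (Suc i))" for i x y
  proof -
    have "0\<^sub>m (s' i) (r (Suc i)) *\<^sub>v x + e' i *\<^sub>v y = e' i *\<^sub>v y"
      using e'[of i] that by (intro eq_vecI) auto
    then show ?thesis
      using four_block_mat_mult_vec[OF c \<phi>' zero_carrier_mat e' that] by (simp add: D_def)
  qed
  have split: "\<exists>x y. x \<in> carrier_vec a \<and> y \<in> carrier_vec b \<and> v = x @\<^sub>v y"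
    if "v \<in> carrier_vec (a + b)" for a b and v :: "('a, 'b) mpoly vec"
    using that vec_first_last_append[OF that] vec_first_carrier vec_last_carrier by metis
  have dim1: "r 0 + s' 0 = 1" using r0 by (simp add: s'_def)
  have imd: "mat_image (d (Suc 0)) = {vec 1 (\<lambda>_. f) | f. f \<in> J}"
    using FG by (simp add: resolves_def)
  have \<phi>0: "\<phi> 0 *\<^sub>v y = vec 1 (\<lambda>_. u * (y $ 0))" if "y \<in> carrier_vec 1" for y
    using that smult_mat_mult_vec[OF one_carrier_mat that, of u]
    by (auto simp: \<phi>(1) intro!: eq_vecI)
  have "mat_image (D 1) = {vec 1 (\<lambda>_. f) | f. f \<in> {f + u * g | f g. f \<in> J}}"
  proof -
    have D1: "D (Suc 0) *\<^sub>v (x @\<^sub>v y) = d (Suc 0) *\<^sub>v x + vec 1 (\<lambda>_. u * (y $ 0))"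
      if "x \<in> carrier_vec (r (Suc 0))" "y \<in> carrier_vec 1" for x y
    proof -
      have "e' 0 *\<^sub>v y = 0\<^sub>v 0" by (auto simp: e'_def)
      then show ?thesis using Dv[of x 0 y] that \<phi>0[OF that(2)] r0 by (auto simp: s'_def intro!: eq_vecI)
    qed
    have s1: "s' (Suc 0) = 1" using r0 by (simp add: s'_def)
    have "v \<in> mat_image (D (Suc 0)) \<longleftrightarrow> (\<exists>x\<in>carrier_vec (r (Suc 0)). \<exists>g.
        v = d (Suc 0) *\<^sub>v x + vec 1 (\<lambda>_. u * g))" for v
    proof
      assume "v \<in> mat_image (D (Suc 0))"
      then obtain w where "w \<in> carrier_vec (r (Suc 0) + 1)" "v = D (Suc 0) *\<^sub>v w"
        using mat_image_iff[OF Dc] s1 by auto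
      then show "\<exists>x\<in>carrier_vec (r (Suc 0)). \<exists>g. v = d (Suc 0) *\<^sub>v x + vec 1 (\<lambda>_. u * g)"
        using split D1 by metis
    next
      assume "\<exists>x\<in>carrier_vec (r (Suc 0)). \<exists>g. v = d (Suc 0) *\<^sub>v x + vec 1 (\<lambda>_. u * g)"
      then obtain x g where xg: "x\<in>carrier_vec (r (Suc 0))" "v = d (Suc 0) *\<^sub>v x + vec 1 (\<lambda>_. u * g)" by auto
      then have "v = D (Suc 0) *\<^sub>v (x @\<^sub>v vec 1 (\<lambda>_. g))" using D1[OF xg(1), of "vec 1 (\<lambda>_. g)"] by simp
      moreover have "x @\<^sub>v vec 1 (\<lambda>_. g) \<in> carrier_vec (r (Suc 0) + 1)"
        using xg(1) by (intro append_carrier_vec) auto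
      ultimately show "v \<in> mat_image (D (Suc 0))"
        unfolding mat_image_iff[OF Dc] s1 by blast
    qed
    also have "\<dots> v \<longleftrightarrow> (\<exists>f\<in>J. \<exists>g. v = vec 1 (\<lambda>_. f) + vec 1 (\<lambda>_. u * g))" for v
    proof -
      have "(\<lambda>x. d (Suc 0) *\<^sub>v x) ` carrier_vec (r (Suc 0)) = mat_image (d (Suc 0))"
        using c[of 0] by (auto simp: mat_image_def)
      then have "(\<lambda>x. d (Suc 0) *\<^sub>v x) ` carrier_vec (r (Suc 0)) = (\<lambda>f. vec 1 (\<lambda>_. f)) ` J"
        unfolding imd by auto
      then have "(\<exists>a\<in>(\<lambda>x. d (Suc 0) *\<^sub>v x) ` carrier_vec (r (Suc 0)). \<exists>g. v = a + vec 1 (\<lambda>_. u * g)) \<longleftrightarrow>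
          (\<exists>a\<in>(\<lambda>f. vec 1 (\<lambda>_. f)) ` J. \<exists>g. v = a + vec 1 (\<lambda>_. u * g))" by (simp only:)
      then show ?thesis by (simp only: bex_simps)
    qed
    also have "\<dots> v \<longleftrightarrow> (\<exists>f\<in>J. \<exists>g. v = vec 1 (\<lambda>_. f + u * g))" for v
    proof -
      have "vec 1 (\<lambda>_. f) + vec 1 (\<lambda>_. u * g) = vec 1 (\<lambda>_. f + u * g)" for f g
        by (intro eq_vecI) auto
      then show ?thesis by simp
    qed
    finally have "v \<in> mat_image (D 1) \<longleftrightarrow> (\<exists>f\<in>J. \<exists>g. v = vec 1 (\<lambda>_. f + u * g))" for v by simp
    then show ?thesis by blast
  qed
  moreover have "mat_kernel (D (Suc i)) = mat_image (D (Suc (Suc i)))" for i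
  proof (intro equalityI subsetI)
    fix v assume v: "v \<in> mat_kernel (D (Suc i))"
    obtain x y where xy: "x \<in> carrier_vec (r (Suc i))" "y \<in> carrier_vec (s' (Suc i))" "v = x @\<^sub>v y"
      using mat_kernelD(1)[OF Dc v] split by blast
    have y: "y \<in> carrier_vec (s i)" using xy(2) by (simp add: s'_def)
    have dx: "d (Suc i) *\<^sub>v x \<in> carrier_vec (r i)" and fy: "\<phi> i *\<^sub>v y \<in> carrier_vec (r i)"
      using mult_mat_vec_carrier[OF c xy(1)] mult_mat_vec_carrier[OF \<phi>(2) y] by auto
    have z: "d (Suc i) *\<^sub>v x + \<phi> i *\<^sub>v y = 0\<^sub>v (r i)" "e' i *\<^sub>v y = 0\<^sub>v (s' i)"
    proof -
      have "(d (Suc i) *\<^sub>v x + \<phi> i *\<^sub>v y) @\<^sub>v (e' i *\<^sub>v y) = 0\<^sub>v (r i + s' i)"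
        using mat_kernelD(2)[OF Dc v] xy Dv by simp
      also have "\<dots> = 0\<^sub>v (r i) @\<^sub>v 0\<^sub>v (s' i)" by (rule eq_vecI) auto
      finally show "d (Suc i) *\<^sub>v x + \<phi> i *\<^sub>v y = 0\<^sub>v (r i)" "e' i *\<^sub>v y = 0\<^sub>v (s' i)"
        using append_vec_eq[OF add_carrier_vec[OF dx fy] zero_carrier_vec] by auto
    qed
    \<comment> \<open>For \<open>i = 0\<close> this is where the colon ideal enters:
      \<open>u\<close> times the entry of \<open>y\<close> lies in \<open>J\<close>. For
      \<open>i > 0\<close> it is exactness of the second resolution.\<close>
    have "\<exists>w\<in>carrier_vec (s (Suc i)). y = e (Suc i) *\<^sub>v w"
    proof (cases i)
      case 0
      have s1: "y \<in> carrier_vec 1" using y 0 r0 by simp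
      have "u * (y $ 0) \<in> J"
      proof -
        have "- x \<in> carrier_vec (r (Suc 0))" using xy 0 by simp
        then have "d (Suc 0) *\<^sub>v (- x) \<in> mat_image (d (Suc 0))" using mat_image_iff[OF c] by auto
        moreover have "d (Suc 0) *\<^sub>v (- x) = vec 1 (\<lambda>_. u * (y $ 0))"
          using mult_mat_uminus_vec[OF c xy(1)] vec_eq_uminus_if_add_eq_0[OF dx fy z(1)] \<phi>0[OF s1] 0
          by simp
        ultimately have "vec 1 (\<lambda>_. u * (y $ 0)) \<in> {vec 1 (\<lambda>_. f) | f. f \<in> J}"
          using imd by metis
        then obtain f where "f \<in> J" "vec 1 (\<lambda>_. u * (y $ 0)) = vec 1 (\<lambda>_. f)" by blast
        then show ?thesis unfolding vec1_eq_iff by simp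
      qed
      then have "vec 1 (\<lambda>_. y $ 0) \<in> {vec 1 (\<lambda>_. f) | f. f \<in> {f. u * f \<in> J}}" by blast
      moreover have "vec 1 (\<lambda>_. y $ 0) = y" using s1 by (intro eq_vecI) auto
      ultimately have "y \<in> {vec 1 (\<lambda>_. f) | f. f \<in> {f. u * f \<in> J}}" by (simp only:)
      then have "y \<in> mat_image (e 1)" using FG(2) by (simp only: resolves_def)
      then show ?thesis using mat_image_iff[OF c', of _ 0] 0 by auto
    next
      case (Suc j)
      have "e (Suc j) *\<^sub>v y = 0\<^sub>v (s j)"
        using z(2) Suc y c'[of j] by (simp add: e'_def s'_def uminus_zero_vec_eq[of _ "s j"])
      then have "y \<in> mat_kernel (e (Suc j))" using y Suc by (intro mat_kernelI[OF c']) auto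
      then have "y \<in> mat_image (e (Suc (Suc j)))" using FG(2) by (auto simp: resolves_def)
      then show ?thesis using mat_image_iff[OF c', of _ "Suc j"] Suc by auto
    qed
    then obtain w where w: "w \<in> carrier_vec (s (Suc i))" "y = e (Suc i) *\<^sub>v w" by auto
    let ?w = "\<phi> (Suc i) *\<^sub>v w"
    have wc: "?w \<in> carrier_vec (r (Suc i))" using mult_mat_vec_carrier[OF \<phi>(2) w(1)] .
    \<comment> \<open>Adding \<open>?w\<close> turns \<open>x\<close> into a cycle of the first
      resolution, because \<open>d x = - \<phi> y = - \<phi> e w = - d \<phi> w\<close>. A preimage
      of this cycle, paired with \<open>- w\<close>, is then a preimage of \<open>v\<close>.\<close>
    have "d (Suc i) *\<^sub>v (x + ?w) = 0\<^sub>v (r i)"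
    proof -
      have "d (Suc i) *\<^sub>v ?w = (\<phi> i * e (Suc i)) *\<^sub>v w"
        using assoc_mult_mat_vec[OF c \<phi>(2) w(1)] \<phi>(3) by simp
      also have "\<dots> = \<phi> i *\<^sub>v y" using assoc_mult_mat_vec[OF \<phi>(2) c' w(1)] w(2) by simp
      finally show ?thesis using mult_add_distrib_mat_vec[OF c xy(1) wc] z(1) by simp
    qed
    then have "x + ?w \<in> mat_kernel (d (Suc i))" using xy wc by (intro mat_kernelI[OF c]) auto
    then obtain x' where x': "x' \<in> carrier_vec (r (Suc (Suc i)))" "x + ?w = d (Suc (Suc i)) *\<^sub>v x'"
      using FG(1) mat_image_iff[OF c] by (auto simp: resolves_def)
    have "v = D (Suc (Suc i)) *\<^sub>v (x' @\<^sub>v (- w))"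
    proof -
      have "x = d (Suc (Suc i)) *\<^sub>v x' + \<phi> (Suc i) *\<^sub>v (- w)"
        unfolding x'(2)[symmetric] mult_mat_uminus_vec[OF \<phi>(2) w(1)]
        using xy(1) wc by (intro eq_vecI) auto
      moreover have "y = e' (Suc i) *\<^sub>v (- w)"
        using w c'[of i] by (simp add: e'_def mult_mat_uminus_vec[OF c'])
      ultimately show ?thesis using Dv[of x' "Suc i" "- w"] x' w xy by (simp add: s'_def)
    qed
    then show "v \<in> mat_image (D (Suc (Suc i)))" using mat_image_iff[OF Dc, of _ "Suc i"] x' w
      by (auto simp: s'_def intro!: bexI[of _ "x' @\<^sub>v (- w)"])
  next
    fix v assume "v \<in> mat_image (D (Suc (Suc i)))"
    then obtain x y where xy: "x \<in> carrier_vec (r (Suc (Suc i)))" "y \<in> carrier_vec (s' (Suc (Suc i)))"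
       "v = D (Suc (Suc i)) *\<^sub>v (x @\<^sub>v y)"
      using mat_image_iff[OF Dc] split by metis
    have y: "y \<in> carrier_vec (s (Suc i))" using xy(2) by (simp add: s'_def)
    let ?x = "d (Suc (Suc i)) *\<^sub>v x + \<phi> (Suc i) *\<^sub>v y" and ?y = "e' (Suc i) *\<^sub>v y"
    have xc: "?x \<in> carrier_vec (r (Suc i))" and yc: "?y \<in> carrier_vec (s' (Suc i))"
      using mult_mat_vec_carrier[OF c xy(1)] mult_mat_vec_carrier[OF \<phi>(2) y]
        mult_mat_vec_carrier[OF e' xy(2)] by auto
    have yc': "?y \<in> carrier_vec (s i)" using yc by (simp add: s'_def)
    have v: "v = ?x @\<^sub>v ?y" using Dv xy by simp
    let ?z = "e (Suc i) *\<^sub>v y"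
    have zc: "?z \<in> carrier_vec (s i)" using mult_mat_vec_carrier[OF c' y] .
    have yz: "?y = - ?z" using y c'[of i] by (simp add: e'_def)
    have "d (Suc i) *\<^sub>v ?x = d (Suc i) *\<^sub>v (d (Suc (Suc i)) *\<^sub>v x) + d (Suc i) *\<^sub>v (\<phi> (Suc i) *\<^sub>v y)"
      using mult_mat_vec_carrier[OF c xy(1)] mult_mat_vec_carrier[OF \<phi>(2) y]
      by (intro mult_add_distrib_mat_vec[OF c]) auto
    also have "\<dots> = 0\<^sub>v (r i) + (\<phi> i * e (Suc i)) *\<^sub>v y"
      using resolves_comp_zero_vec[OF FG(1) xy(1)] assoc_mult_mat_vec[OF c \<phi>(2) y] \<phi>(3) by simp
    also have "\<dots> = 0\<^sub>v (r i) + \<phi> i *\<^sub>v ?z"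
      using assoc_mult_mat_vec[OF \<phi>(2) c' y] by simp
    finally have "d (Suc i) *\<^sub>v ?x + \<phi> i *\<^sub>v ?y = 0\<^sub>v (r i)"
      unfolding yz mult_mat_uminus_vec[OF \<phi>(2) zc]
      using \<phi>(2)[of i] by (intro eq_vecI) auto
    moreover have "e' i *\<^sub>v ?y = 0\<^sub>v (s' i)"
    proof (cases i)
      case 0
      then show ?thesis by (auto simp: e'_def s'_def)
    next
      case (Suc j)
      have "e (Suc j) *\<^sub>v ?z = 0\<^sub>v (s j)"
        using resolves_comp_zero_vec[OF FG(2)] y Suc by simp
      moreover have "dim_vec ?z = dim_col (e (Suc j))" using carrier_vecD[OF zc] c'[of j] Suc by auto
      ultimately show ?thesis
        unfolding yz using mult_mat_uminus_vec[OF c' zc[unfolded Suc]] Suc zc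
        by (simp add: e'_def s'_def)
    qed
    ultimately have "D (Suc i) *\<^sub>v v = 0\<^sub>v (r i) @\<^sub>v 0\<^sub>v (s' i)"
      unfolding v using Dv[OF xc yc] by simp
    also have "\<dots> = 0\<^sub>v (r i + s' i)" by (rule eq_vecI) auto
    finally show "v \<in> mat_kernel (D (Suc i))"
      using v xc yc by (intro mat_kernelI[OF Dc]) auto
  qed
  moreover have "homog_mat \<delta> (D 1)"
  proof -
    have "homog_mat \<delta> (\<phi> 0)" using u by (auto simp: \<phi>(1) homog_mat_def)
    then show ?thesis using F homog_mat_four_block[OF c \<phi>' zero_carrier_mat e', of \<delta> 0]
      by (simp add: D_def linear_resolution_def homog_mat_def s'_def e'_def)
  qed
  moreover have "homog_mat 1 (D (Suc (Suc i)))" for i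
  proof -
    have "homog_mat 1 (e' (Suc i))" using e[of i] by (auto simp: e'_def homog_mat_def homogeneous_def)
    then show ?thesis using F \<phi>(4) homog_mat_four_block[OF c \<phi>' zero_carrier_mat e', of 1 "Suc i"]
      by (simp add: D_def linear_resolution_def) (simp add: homog_mat_def homogeneous_def)
  qed
  ultimately have "linear_resolution {f + u * g | f g. f \<in> J} \<delta> (\<lambda>i. r i + s' i) D"
    using dim1 Dc by (auto simp: linear_resolution_def resolves_def)
  then show ?thesis using that by (simp add: s'_def)
qed

section \<open>Monomial ideals\<close>

interpretation ideal: Modules.module "(*) :: 'a::comm_ring_1 \<Rightarrow> 'a \<Rightarrow> 'a"
  by unfold_locales (auto simp: algebra_simps)

abbreviation monomial :: "('n \<Rightarrow>\<^sub>0 nat) \<Rightarrow> ('n, 'k::comm_ring_1) mpoly"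
  where "monomial t \<equiv> Poly_Mapping.single t 1"

text \<open>\<open>s = t + v\<close> for some \<open>v\<close> says that the monomial with exponent \<open>t\<close> divides the one with exponent \<open>s\<close>.\<close>

definition monomial_ideal :: "('n \<Rightarrow>\<^sub>0 nat) set \<Rightarrow> ('n, 'k::comm_ring_1) mpoly set"
  where "monomial_ideal T = {f. \<forall>s\<in>Poly_Mapping.keys f. \<exists>t\<in>T. \<exists>v. s = t + v}"

lemma exponent_le_iff:
  fixes s t :: "'n \<Rightarrow>\<^sub>0 nat"
  shows "(\<exists>v. s = t + v) \<longleftrightarrow> (\<forall>x. Poly_Mapping.lookup t x \<le> Poly_Mapping.lookup s x)"
proof
  assume "\<forall>x. Poly_Mapping.lookup t x \<le> Poly_Mapping.lookup s x"
  then have "s = t + (s - t)" by (intro poly_mapping_eqI) (simp add: lookup_add lookup_minus)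
  then show "\<exists>v. s = t + v" by blast
qed (auto simp: lookup_add)

lemma poly_mapping_sum_single:
  fixes f :: "'a \<Rightarrow>\<^sub>0 'b::comm_monoid_add"
  shows "f = (\<Sum>s\<in>Poly_Mapping.keys f. Poly_Mapping.single s (Poly_Mapping.lookup f s))"
  by (rule poly_mapping_eqI) (auto simp: lookup_sum lookup_single when_def sum.delta in_keys_iff)

lemma lookup_monomial_mult:
  fixes t v :: "'n \<Rightarrow>\<^sub>0 nat"
  shows "Poly_Mapping.lookup (monomial t * f) (t + v) = Poly_Mapping.lookup f v"
proof -
  have "monomial t * f = (\<Sum>s\<in>Poly_Mapping.keys f. Poly_Mapping.single (t + s) (Poly_Mapping.lookup f s))"
    by (subst poly_mapping_sum_single[of f]) (simp add: sum_distrib_left mult_single)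
  then show ?thesis
    by (simp add: lookup_sum lookup_single when_def sum.delta in_keys_iff)
qed

lemma keys_monomial_mult:
  fixes t :: "'n \<Rightarrow>\<^sub>0 nat" and f :: "('n, 'k::comm_ring_1) mpoly"
  shows "Poly_Mapping.keys (monomial t * f) = (+) t ` Poly_Mapping.keys f"
proof
  show "Poly_Mapping.keys (monomial t * f) \<subseteq> (+) t ` Poly_Mapping.keys f"
    using keys_mult[of "monomial t :: ('n, 'k) mpoly" f] by (auto split: if_splits)
qed (auto simp: in_keys_iff lookup_monomial_mult)

text \<open>Turns questions about ideals into divisibility conditions on single exponents:
  multiplication only enlarges exponents, and each term of a member is itself a multiple of a
  generator.\<close>

lemma ideal_gen_monomials: "ideal_gen (monomial ` T) = monomial_ideal T"
proof
  have "Modules.module.subspace (*) (monomial_ideal T :: ('a, 'b) mpoly set)"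
  proof (rule ideal.subspaceI)
    show "0 \<in> (monomial_ideal T :: ('a, 'b) mpoly set)" by (simp add: monomial_ideal_def)
  next
    fix f g :: "('a, 'b) mpoly" assume "f \<in> monomial_ideal T" "g \<in> monomial_ideal T"
    then show "f + g \<in> monomial_ideal T" using Poly_Mapping.keys_add[of f g]
      by (fastforce simp: monomial_ideal_def)
  next
    fix c f :: "('a, 'b) mpoly" assume f: "f \<in> monomial_ideal T"
    show "c * f \<in> monomial_ideal T" unfolding monomial_ideal_def
    proof safe
      fix s assume "s \<in> Poly_Mapping.keys (c * f)"
      then obtain a b where "s = a + b" "b \<in> Poly_Mapping.keys f" using keys_mult by blast
      moreover from this obtain t v where "t \<in> T" "b = t + v"
        using f by (auto simp: monomial_ideal_def)
      ultimately show "\<exists>t\<in>T. \<exists>v. s = t + v"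
        by (intro bexI[of _ t] exI[of _ "a + v"]) (auto simp: algebra_simps)
    qed
  qed
  then show "ideal_gen (monomial ` T) \<subseteq> (monomial_ideal T :: ('a, 'b) mpoly set)"
    unfolding ideal_gen_def by (intro ideal.span_minimal)
      (auto simp: monomial_ideal_def intro!: bexI exI[of _ 0])
  show "monomial_ideal T \<subseteq> (ideal_gen (monomial ` T) :: ('a, 'b) mpoly set)"
  proof
    fix f :: "('a, 'b) mpoly" assume f: "f \<in> monomial_ideal T"
    have "Poly_Mapping.single s (Poly_Mapping.lookup f s) \<in> ideal_gen (monomial ` T)"
      if s: "s \<in> Poly_Mapping.keys f" for s
    proof -
      obtain t v where tv: "t \<in> T" "s = t + v" using f s by (auto simp: monomial_ideal_def)
      have "Poly_Mapping.single s (Poly_Mapping.lookup f s) =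
          Poly_Mapping.single v (Poly_Mapping.lookup f s) * monomial t"
        by (simp add: tv(2) mult_single add.commute)
      then show ?thesis unfolding ideal_gen_def using tv(1)
        by (metis ideal.span_base ideal.span_scale imageI)
    qed
    then have "(\<Sum>s\<in>Poly_Mapping.keys f. Poly_Mapping.single s (Poly_Mapping.lookup f s))
        \<in> ideal_gen (monomial ` T)"
      unfolding ideal_gen_def by (intro ideal.span_sum) auto
    then show "f \<in> ideal_gen (monomial ` T)" using poly_mapping_sum_single[of f] by simp
  qed
qed

text \<open>The right-hand side is the form of the ideal that \<open>linear_resolution_cone\<close>
  resolves.\<close>

lemma monomial_ideal_insert:
  "monomial_ideal (insert t T) = {f + monomial t * g | f g. f \<in> monomial_ideal T}"
proof -
  have "x - k * monomial t \<in> ideal_gen (monomial ` T) \<longleftrightarrow>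
      (\<exists>f\<in>ideal_gen (monomial ` T). x = f + monomial t * k)" for x k :: "('a, 'b) mpoly"
  proof
    assume "x - k * monomial t \<in> ideal_gen (monomial ` T)"
    then show "\<exists>f\<in>ideal_gen (monomial ` T). x = f + monomial t * k"
      by (intro bexI[of _ "x - k * monomial t"]) (auto simp: mult.commute)
  qed (auto simp: mult.commute)
  then show ?thesis
    unfolding ideal_gen_monomials[symmetric] image_insert
    unfolding ideal_gen_def ideal.span_insert by auto
qed

text \<open>An exponent is nonzero exactly if some variable divides its monomial. Minimality of a
  resolution thus means that taking constant terms kills all entries.\<close>

lemma maximal_homogeneous_ideal_eq:
  "maximal_homogeneous_ideal = {f :: ('n::finite, 'k::comm_ring_1) mpoly. Poly_Mapping.lookup f 0 = 0}"
proof -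
  have "maximal_homogeneous_ideal = (monomial_ideal (range (\<lambda>x. Poly_Mapping.single x 1)) :: ('n, 'k) mpoly set)"
    unfolding maximal_homogeneous_ideal_def ideal_gen_monomials[symmetric]
    by (simp add: image_image Var_def)
  moreover have "(\<exists>t\<in>range (\<lambda>x. Poly_Mapping.single x 1). \<exists>v. s = t + v) \<longleftrightarrow> s \<noteq> 0" for s :: "'n \<Rightarrow>\<^sub>0 nat"
  proof -
    have "(\<forall>y. Poly_Mapping.lookup (Poly_Mapping.single x (1::nat)) y \<le> Poly_Mapping.lookup s y) \<longleftrightarrow>
        Poly_Mapping.lookup s x \<noteq> 0" for x
      by (auto simp: lookup_single when_def)
    then have "(\<exists>t\<in>range (\<lambda>x. Poly_Mapping.single x 1). \<exists>v. s = t + v) \<longleftrightarrow> (\<exists>x. Poly_Mapping.lookup s x \<noteq> 0)"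
      by (simp add: exponent_le_iff)
    then show ?thesis by (metis lookup_zero poly_mapping_eqI)
  qed
  ultimately have "maximal_homogeneous_ideal = {f :: ('n, 'k) mpoly. \<forall>s\<in>Poly_Mapping.keys f. s \<noteq> 0}"
    by (simp add: monomial_ideal_def)
  moreover have "(\<forall>s\<in>Poly_Mapping.keys f. s \<noteq> 0) \<longleftrightarrow> Poly_Mapping.lookup f 0 = 0"
    for f :: "('n, 'k) mpoly" using in_keys_iff[of 0 f] by metis
  ultimately show ?thesis by simp
qed

text \<open>This is the residue map modulo the variables. For multiplicativity both factors are
  split into constant term and rest; every product involving a rest lies in the ideal of the
  variables.\<close>

lemma constant_term_hom: "semiring_hom (\<lambda>f :: ('n::finite, 'k::comm_ring_1) mpoly. Poly_Mapping.lookup f 0)"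
proof
  fix f g :: "('n, 'k) mpoly"
  define c :: "('n, 'k) mpoly \<Rightarrow> ('n, 'k) mpoly"
    where "c f = Poly_Mapping.single 0 (Poly_Mapping.lookup f 0)" for f
  have m: "Poly_Mapping.lookup (f * g) 0 = 0"
    if "Poly_Mapping.lookup f 0 = 0" for f g :: "('n, 'k) mpoly"
  proof -
    have "f \<in> maximal_homogeneous_ideal" using that by (simp add: maximal_homogeneous_ideal_eq)
    then have "g * f \<in> maximal_homogeneous_ideal"
      unfolding maximal_homogeneous_ideal_def ideal_gen_def by (rule ideal.span_scale)
    then show ?thesis by (simp add: maximal_homogeneous_ideal_eq mult.commute)
  qed
  have c: "Poly_Mapping.lookup (h - c h) 0 = 0" for h by (simp add: c_def lookup_minus)
  have "Poly_Mapping.lookup (f * g) 0 =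
      Poly_Mapping.lookup ((f - c f) * g + ((g - c g) * c f + c f * c g)) 0"
    by (rule arg_cong[of _ _ "\<lambda>h. Poly_Mapping.lookup h 0"]) (simp add: algebra_simps)
  also have "\<dots> = Poly_Mapping.lookup ((f - c f) * g) 0 +
      (Poly_Mapping.lookup ((g - c g) * c f) 0 + Poly_Mapping.lookup (c f * c g) 0)"
    by (simp only: lookup_add)
  also have "\<dots> = Poly_Mapping.lookup (c f * c g) 0"
    using m[OF c] by simp
  finally show "Poly_Mapping.lookup (f * g) 0 = Poly_Mapping.lookup f 0 * Poly_Mapping.lookup g 0"
    by (simp add: c_def mult_single)
qed (auto simp: lookup_add lookup_one)

section \<open>Generators of the powers of the squarefree ideal\<close>

definition bounded_exponents :: "nat \<Rightarrow> ('n::finite \<Rightarrow>\<^sub>0 nat) set"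
  where "bounded_exponents k = {t. mdeg t = 2 * k \<and> (\<forall>x. Poly_Mapping.lookup t x \<le> k)}"

lemma squarefree_deg2_ideal_eq: "squarefree_deg2_ideal = monomial_ideal (bounded_exponents 1)"
  unfolding squarefree_deg2_ideal_def ideal_gen_monomials[symmetric]
  by (rule arg_cong[of _ _ ideal_gen]) (auto simp: bounded_exponents_def)

lemma bounded_exponents_add:
  "s \<in> bounded_exponents j \<Longrightarrow> t \<in> bounded_exponents k \<Longrightarrow> s + t \<in> bounded_exponents (j + k)"
  by (auto simp: bounded_exponents_def mdeg_add lookup_add intro: add_mono)

lemma mdeg_single [simp]: "mdeg (Poly_Mapping.single x a) = a"
  by (simp add: mdeg_def lookup_single when_def sum.delta)

text \<open>Peels off the product of two variables with the largest exponents. A third exponent of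
  \<open>k + 1\<close> would force the degree up to \<open>3k + 3\<close>, so the remaining
  exponents are at most \<open>k\<close>. In graph terms, \<open>t\<close> is the degree sequence of
  a loopless multigraph that loses an edge.\<close>

lemma bounded_exponents_Suc:
  assumes t: "t \<in> bounded_exponents (Suc k)"
  obtains q s where "q \<in> bounded_exponents 1" "s \<in> bounded_exponents k" "t = s + q"
proof -
  let ?t = "Poly_Mapping.lookup t"
  have deg: "sum ?t UNIV = 2 * Suc k" and le: "\<And>z. ?t z \<le> Suc k"
    using t by (auto simp: bounded_exponents_def mdeg_def)
  obtain x where x: "\<And>z. ?t z \<le> ?t x"
    using Max_in[of "range ?t"] Max_ge[of "range ?t"] by fastforce
  \<comment> \<open>The exponent of \<open>x\<close> is at most half of the degree, so a second
    variable occurs.\<close>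
  have rest: "sum ?t (UNIV - {x}) \<ge> Suc k"
    using deg le[of x] by (simp add: sum.remove[of UNIV x])
  have ne: "?t ` (UNIV - {x}) \<noteq> {}"
  proof
    assume "?t ` (UNIV - {x}) = {}"
    then have "sum ?t (UNIV - {x}) = 0" by (simp only: image_is_empty sum.empty)
    then show False using rest by simp
  qed
  obtain y where y: "y \<noteq> x" "\<And>z. z \<noteq> x \<Longrightarrow> ?t z \<le> ?t y"
    using Max_in[OF _ ne] Max_ge[of "?t ` (UNIV - {x})"] by fastforce
  have "?t y \<noteq> 0"
  proof
    assume "?t y = 0"
    then have "sum ?t (UNIV - {x}) = 0" using y(2) by (intro sum.neutral) auto
    then show False using rest by simp
  qed
  then have ty: "?t y \<ge> 1" and tx: "?t x \<ge> 1" using x[of y] by auto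
  have others: "?t z \<le> k" if "z \<noteq> x" "z \<noteq> y" for z
  proof (rule ccontr)
    assume "\<not> ?t z \<le> k"
    then have "?t z \<ge> Suc k" "?t y \<ge> Suc k" "?t x \<ge> Suc k" using that x[of z] y(2)[of z] by auto
    moreover have "?t x + ?t y + ?t z \<le> sum ?t UNIV"
      using that y(1) sum_mono2[of UNIV "{x, y, z}" ?t] by simp
    ultimately show False using deg by simp
  qed
  define q :: "'a \<Rightarrow>\<^sub>0 nat" where "q = Poly_Mapping.single x 1 + Poly_Mapping.single y 1"
  have q: "Poly_Mapping.lookup q z = (if z = x \<or> z = y then 1 else 0)" for z
    using y(1) by (auto simp: q_def lookup_add lookup_single when_def)
  have tq: "t = (t - q) + q"
    using tx ty by (intro poly_mapping_eqI) (auto simp: lookup_add lookup_minus q)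
  have mq: "mdeg q = 2" by (simp add: q_def mdeg_add)
  show ?thesis
  proof
    show "q \<in> bounded_exponents 1" using q mq by (simp add: bounded_exponents_def)
    have "mdeg t = mdeg (t - q) + mdeg q" using tq mdeg_add by metis
    then have "mdeg (t - q) = 2 * k" using deg mq by (simp add: mdeg_def)
    moreover have "Poly_Mapping.lookup (t - q) z \<le> k" for z
      using others[of z] le[of z] by (auto simp: lookup_minus q)
    ultimately show "t - q \<in> bounded_exponents k" by (simp add: bounded_exponents_def)
  qed (rule tq)
qed

text \<open>The definition of the power admits arbitrary elements of the ideal as factors, so the
  inclusion from left to right follows all terms of their product. The converse splits each bounded
  exponent into \<open>k\<close> squarefree ones.\<close>

lemma ideal_power_squarefree_deg2:
  "ideal_power squarefree_deg2_ideal k =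
    (monomial_ideal (bounded_exponents k) :: ('n::finite, 'k::field) mpoly set)"
proof
  let ?I = "squarefree_deg2_ideal :: ('n, 'k) mpoly set"
  have prod: "(\<Prod>j<k. f j) \<in> (monomial_ideal (bounded_exponents k) :: ('n, 'k) mpoly set)"
    if "\<forall>j<k. f j \<in> ?I" for k f
    using that
  proof (induction k)
    case 0
    have "0 \<in> bounded_exponents 0" by (simp add: bounded_exponents_def mdeg_def)
    then show ?case by (force simp: monomial_ideal_def)
  next
    case (Suc k)
    let ?p = "\<Prod>j<k. f j"
    have p: "?p \<in> monomial_ideal (bounded_exponents k)"
      and g: "f k \<in> monomial_ideal (bounded_exponents 1)"
      using Suc by (auto simp: squarefree_deg2_ideal_eq)
    have "\<exists>t\<in>bounded_exponents (Suc k). \<exists>v. s = t + v" if s: "s \<in> Poly_Mapping.keys (?p * f k)" for s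
    proof -
      obtain a b where "s = a + b" "a \<in> Poly_Mapping.keys ?p" "b \<in> Poly_Mapping.keys (f k)"
        using keys_mult s by blast
      moreover from this obtain t v t' v' where "t \<in> bounded_exponents k" "a = t + v"
          "t' \<in> bounded_exponents 1" "b = t' + v'"
        using p g by (fastforce simp: monomial_ideal_def)
      ultimately show ?thesis using bounded_exponents_add[of t k t' 1]
        by (intro bexI[of _ "t + t'"] exI[of _ "v + v'"]) (auto simp: algebra_simps)
    qed
    then show ?case by (simp add: monomial_ideal_def)
  qed
  have "Modules.module.subspace (*) (monomial_ideal (bounded_exponents k) :: ('n, 'k) mpoly set)"
    unfolding ideal_gen_monomials[symmetric] ideal_gen_def by (rule ideal.subspace_span)
  then show "ideal_power ?I k \<subseteq> monomial_ideal (bounded_exponents k)"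
    unfolding ideal_power_def ideal_gen_def using prod by (intro ideal.span_minimal) auto
  have fact: "\<exists>f. (\<forall>j<k. f j \<in> ?I) \<and> monomial t = (\<Prod>j<k. f j)"
    if "t \<in> bounded_exponents k" for k t
    using that
  proof (induction k arbitrary: t)
    case 0
    then have "t = 0" by (intro poly_mapping_eqI) (auto simp: bounded_exponents_def)
    then show ?case by simp
  next
    case (Suc k)
    obtain q s where qs: "q \<in> bounded_exponents 1" "s \<in> bounded_exponents k" "t = s + q"
      using bounded_exponents_Suc[OF Suc.prems] .
    obtain f where f: "\<forall>j<k. f j \<in> ?I" "monomial s = (\<Prod>j<k. f j)" using Suc.IH[OF qs(2)] by blast
    have "monomial q \<in> ?I"
      unfolding squarefree_deg2_ideal_eq ideal_gen_monomials[symmetric] ideal_gen_def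
      using qs(1) by (intro ideal.span_base) auto
    moreover have "monomial t = monomial s * (monomial q :: ('n, 'k) mpoly)" by (simp add: qs(3) mult_single)
    ultimately show ?case using f
      by (intro exI[of _ "f(k := monomial q)"]) (auto simp: less_Suc_eq)
  qed
  show "monomial_ideal (bounded_exponents k) \<subseteq> ideal_power ?I k"
    unfolding ideal_gen_monomials[symmetric] ideal_power_def ideal_gen_def
    using fact by (intro ideal.span_mono) blast
qed

section \<open>Linear quotients\<close>

text \<open>Multiplication by a monomial translates the exponents, so membership in the colon ideal
  can be tested one exponent at a time.\<close>

lemma monomial_ideal_colon:
  fixes t :: "'n \<Rightarrow>\<^sub>0 nat"
  assumes "\<And>s. (\<exists>u\<in>U. \<exists>v. t + s = u + v) \<longleftrightarrow> (\<exists>u\<in>W. \<exists>v. s = u + v)"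
  shows "{f. monomial t * f \<in> monomial_ideal U} = monomial_ideal W"
  by (simp only: monomial_ideal_def mem_Collect_eq keys_monomial_mult ball_simps assms)

lemma homogeneous_monomial: "homogeneous (int (mdeg t)) (monomial t)"
  by (simp add: homogeneous_def)

lemma monomial_ideal_empty: "monomial_ideal {} = {0}"
  by (auto simp: monomial_ideal_def)

lemma linear_resolution_insert_monomial:
  fixes r s :: "nat \<Rightarrow> nat" and d e :: "nat \<Rightarrow> ('n::finite, 'k::comm_ring_1) mpoly mat"
  assumes J: "linear_resolution (monomial_ideal U) (mdeg t) r d"
    and W: "linear_resolution (monomial_ideal W) 1 s e"
    and colon: "\<And>s. (\<exists>u\<in>U. \<exists>v. t + s = u + v) \<longleftrightarrow> (\<exists>u\<in>W. \<exists>v. s = u + v)"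
  shows "\<exists>D :: nat \<Rightarrow> ('n, 'k) mpoly mat. linear_resolution (monomial_ideal (insert t U)) (mdeg t)
    (\<lambda>i. r i + (if i = 0 then 0 else s (i - 1))) D"
proof -
  have W': "linear_resolution {f. monomial t * f \<in> monomial_ideal U} 1 s e"
    using W unfolding monomial_ideal_colon[OF colon] .
  obtain D :: "nat \<Rightarrow> ('n, 'k) mpoly mat" where "linear_resolution {f + monomial t * g | f g. f \<in> monomial_ideal U} (mdeg t)
      (\<lambda>i. r i + (if i = 0 then 0 else s (i - 1))) D"
    using linear_resolution_cone[OF J W' homogeneous_monomial] .
  then show ?thesis unfolding monomial_ideal_insert by (intro exI[of _ D])
qed

lemma var_divides_iff:
  "(\<exists>u\<in>(\<lambda>x. Poly_Mapping.single x 1) ` A. \<exists>v. s = u + v) \<longleftrightarrow>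
    (\<exists>x\<in>A. Poly_Mapping.lookup s x \<ge> (1::nat))"
  unfolding exponent_le_iff by (auto simp: lookup_single when_def)

text \<open>The Koszul complex as an iterated cone: the ideal of the variables in \<open>A\<close>
  is its own colon ideal by a further variable \<open>x\<close>, so one resolution is both source
  and target, and the ranks add up by Pascal's rule.\<close>

lemma linear_resolution_koszul:
  assumes "finite (A :: 'n::finite set)"
  shows "\<exists>d. linear_resolution (monomial_ideal ((\<lambda>x. Poly_Mapping.single x 1) ` A) ::
    ('n, 'k::comm_ring_1) mpoly set) 1 (\<lambda>i. card A choose i) d"
  using assms
proof (induction A)
  case empty
  have "(\<lambda>i. card ({} :: 'n set) choose i) = (\<lambda>i. if i = 0 then 1 else 0)" by auto
  then show ?case using linear_resolution_zero by (auto simp: monomial_ideal_empty)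
next
  case (insert x A)
  let ?T = "(\<lambda>x. Poly_Mapping.single x (1::nat)) ` A"
  have colon: "(\<exists>u\<in>?T. \<exists>v. Poly_Mapping.single x 1 + s = u + v) \<longleftrightarrow> (\<exists>u\<in>?T. \<exists>v. s = u + v)" for s
    unfolding var_divides_iff using insert.hyps(2) by (auto simp: lookup_add lookup_single when_def)
  obtain d where d: "linear_resolution (monomial_ideal ?T :: ('n, 'k) mpoly set) 1 (\<lambda>i. card A choose i) d"
    using insert.IH by blast
  have "(\<lambda>i. (card A choose i) + (if i = 0 then 0 else card A choose (i - 1))) =
      (\<lambda>i. card (insert x A) choose i)"
  proof
    fix i show "(card A choose i) + (if i = 0 then 0 else card A choose (i - 1)) = card (insert x A) choose i"
      using insert.hyps by (cases i) auto
  qed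
  then show ?case
    using linear_resolution_insert_monomial[where t = "Poly_Mapping.single x 1", unfolded mdeg_single, OF d d colon]
    by (simp add: insert_commute)
qed

text \<open>The index type carries no order, so \<open>e\<close> numbers the variables; the one with
  the smallest number is compared first.\<close>

definition lex_greater :: "('n \<Rightarrow> nat) \<Rightarrow> ('n \<Rightarrow>\<^sub>0 nat) \<Rightarrow> ('n \<Rightarrow>\<^sub>0 nat) \<Rightarrow> bool"
  where "lex_greater e s t \<longleftrightarrow> (\<exists>x. Poly_Mapping.lookup t x < Poly_Mapping.lookup s x \<and>
    (\<forall>y. e y < e x \<longrightarrow> Poly_Mapping.lookup s y = Poly_Mapping.lookup t y))"

lemma lex_greater_irrefl: "\<not> lex_greater e t t"
  by (auto simp: lex_greater_def)

lemma lex_greater_trans: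
  assumes "inj e" "lex_greater e s t" "lex_greater e t u"
  shows "lex_greater e s u"
proof -
  obtain x where x: "Poly_Mapping.lookup t x < Poly_Mapping.lookup s x"
      "\<And>y. e y < e x \<Longrightarrow> Poly_Mapping.lookup s y = Poly_Mapping.lookup t y"
    using assms(2) by (auto simp: lex_greater_def)
  obtain x' where x': "Poly_Mapping.lookup u x' < Poly_Mapping.lookup t x'"
      "\<And>y. e y < e x' \<Longrightarrow> Poly_Mapping.lookup t y = Poly_Mapping.lookup u y"
    using assms(3) by (auto simp: lex_greater_def)
  show ?thesis
  proof (cases "e x" "e x'" rule: linorder_cases)
    case less
    then show ?thesis using x x' unfolding lex_greater_def by (intro exI[of _ x]) auto
  next
    case equal
    then have "x = x'" using assms(1) by (simp add: inj_eq)
    then show ?thesis using x x' unfolding lex_greater_def by (intro exI[of _ x]) auto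
  next
    case greater
    then show ?thesis using x x' unfolding lex_greater_def by (intro exI[of _ x']) auto
  qed
qed

lemma lex_greater_total:
  fixes s t :: "'n::finite \<Rightarrow>\<^sub>0 nat"
  assumes "inj e" "s \<noteq> t"
  shows "lex_greater e s t \<or> lex_greater e t s"
proof -
  let ?P = "\<lambda>x. Poly_Mapping.lookup s x \<noteq> Poly_Mapping.lookup t x"
  have "\<exists>x. ?P x" using assms(2) by (metis poly_mapping_eqI)
  then obtain x where "?P x" "\<And>y. e y < e x \<Longrightarrow> \<not> ?P y"
    using ex_has_least_nat[of ?P _ e] by (metis leD)
  then show ?thesis unfolding lex_greater_def by (metis linorder_neqE_nat)
qed

text \<open>The induction hypothesis concerns the whole set of predecessors of \<open>t\<close>, as
  linear quotients demand. The induction runs over initial segments \<open>V\<close>, by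
  cardinality.\<close>

lemma linear_order_induct:
  assumes fin: "finite T"
    and irrefl: "\<And>t. t \<in> T \<Longrightarrow> \<not> L t t"
    and trans: "\<And>s t u. L s t \<Longrightarrow> L t u \<Longrightarrow> L s u"
    and total: "\<And>s t. s \<in> T \<Longrightarrow> t \<in> T \<Longrightarrow> s \<noteq> t \<Longrightarrow> L s t \<or> L t s"
    and empty: "P {}"
    and step: "\<And>t. t \<in> T \<Longrightarrow> P {s \<in> T. L s t} \<Longrightarrow> P (insert t {s \<in> T. L s t})"
  shows "P T"
proof -
  have "P V" if "V \<subseteq> T" "\<And>s t. t \<in> V \<Longrightarrow> s \<in> T \<Longrightarrow> L s t \<Longrightarrow> s \<in> V" for V
    using that
  proof (induction "card V" arbitrary: V rule: less_induct)
    case less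
    have finV: "finite V" using less.prems(1) fin by (rule finite_subset)
    show ?case
    proof (cases "V = {}")
      case False
      \<comment> \<open>The last element of \<open>V\<close> is found as one with the most
        predecessors.\<close>
      obtain t where t: "t \<in> V" "\<And>s. s \<in> V \<Longrightarrow> card {u \<in> T. L u s} \<le> card {u \<in> T. L u t}"
      proof -
        let ?f = "\<lambda>s. card {u \<in> T. L u s}"
        have "Max (?f ` V) \<in> ?f ` V" using finV False by (intro Max_in) auto
        then obtain t where "t \<in> V" "?f t = Max (?f ` V)" by auto
        then show ?thesis using that[of t] finV by simp
      qed
      have last: "\<not> L t s" if "s \<in> V" for s
      proof
        assume "L t s"
        then have "insert t {u \<in> T. L u t} \<subseteq> {u \<in> T. L u s}"
          using t(1) less.prems(1) trans by auto
        then have "card (insert t {u \<in> T. L u t}) \<le> card {u \<in> T. L u s}"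
          using fin by (intro card_mono) auto
        then show False using fin irrefl[of t] t(2)[OF that] t(1) less.prems(1) by auto
      qed
      have V: "V = insert t {s \<in> T. L s t}"
        using t(1) last total less.prems by blast
      have "t \<notin> {s \<in> T. L s t}" using irrefl t(1) less.prems(1) by auto
      then have "card {s \<in> T. L s t} < card V"
        using V fin by (metis (no_types, lifting) card_insert_disjoint finite_subset less_Suc_eq mem_Collect_eq subsetI)
      then have "P {s \<in> T. L s t}"
        using trans by (intro less.hyps) auto
      then show ?thesis using step[of t] t(1) less.prems(1) V by auto
    qed (simp add: empty)
  qed
  then show ?thesis by blast
qed

text \<open>
  The variables \<open>x\<close> for which \<open>t\<close> can be made lexicographically larger by trading a later variable
  for \<open>x\<close>; they generate the colon ideal of the larger generators by \<open>t\<close>.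
\<close>

definition linear_vars :: "('n \<Rightarrow> nat) \<Rightarrow> nat \<Rightarrow> ('n \<Rightarrow>\<^sub>0 nat) \<Rightarrow> 'n set"
  where "linear_vars e k t = {x. Poly_Mapping.lookup t x < k \<and> (\<exists>y. e x < e y \<and> Poly_Mapping.lookup t y > 0)}"

lemma finite_mdeg: "finite {t :: 'n::finite \<Rightarrow>\<^sub>0 nat. mdeg t = m}"
proof (rule finite_imageD)
  have "Poly_Mapping.lookup ` {t :: 'n \<Rightarrow>\<^sub>0 nat. mdeg t = m} \<subseteq> Pi\<^sub>E UNIV (\<lambda>_. {..m})"
    by (auto simp: mdeg_def intro!: member_le_sum)
  then show "finite (Poly_Mapping.lookup ` {t :: 'n \<Rightarrow>\<^sub>0 nat. mdeg t = m})"
    by (rule finite_subset) (auto intro!: finite_PiE)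
qed (auto simp: inj_on_def intro: poly_mapping_eqI)

lemma finite_bounded_exponents: "finite (bounded_exponents k)"
  using finite_mdeg[of "2 * k"] by (rule rev_finite_subset) (auto simp: bounded_exponents_def)

text \<open>Let a larger generator \<open>u\<close> divide \<open>t + s\<close>, and let
  \<open>x\<close> be the first variable where it differs from \<open>t\<close>. The exponent of
  \<open>x\<close> in \<open>t\<close> is below \<open>k\<close>, and equality of degrees forces
  some later variable to occur in \<open>t\<close>, so \<open>x\<close> is a linear variable
  dividing \<open>s\<close>.\<close>

lemma linear_quotients:
  fixes t :: "'n::finite \<Rightarrow>\<^sub>0 nat"
  assumes e: "inj e" and t: "t \<in> bounded_exponents k"
  shows "(\<exists>u\<in>{u \<in> bounded_exponents k. lex_greater e u t}. \<exists>v. t + s = u + v) \<longleftrightarrow>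
    (\<exists>x\<in>linear_vars e k t. Poly_Mapping.lookup s x \<ge> 1)"
proof
  assume "\<exists>u\<in>{u \<in> bounded_exponents k. lex_greater e u t}. \<exists>v. t + s = u + v"
  then obtain u where u: "u \<in> bounded_exponents k" "lex_greater e u t"
      "\<And>x. Poly_Mapping.lookup u x \<le> Poly_Mapping.lookup t x + Poly_Mapping.lookup s x"
    by (auto simp: exponent_le_iff lookup_add)
  obtain x where x: "Poly_Mapping.lookup t x < Poly_Mapping.lookup u x"
      "\<And>y. e y < e x \<Longrightarrow> Poly_Mapping.lookup u y = Poly_Mapping.lookup t y"
    using u(2) by (auto simp: lex_greater_def)
  have "\<exists>y. e x < e y \<and> Poly_Mapping.lookup t y > 0"
  proof (rule ccontr)
    assume "\<not> ?thesis"
    then have z: "Poly_Mapping.lookup t y = 0" if "e x < e y" for y using that by auto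
    have "Poly_Mapping.lookup t y \<le> Poly_Mapping.lookup u y" for y
    proof (cases "e y" "e x" rule: linorder_cases)
      case equal
      then show ?thesis using x(1) e by (simp add: inj_eq)
    qed (use z x in auto)
    then have "mdeg t < mdeg u" unfolding mdeg_def using x(1) by (intro sum_strict_mono_ex1) auto
    then show False using t u(1) by (simp add: bounded_exponents_def)
  qed
  moreover have "Poly_Mapping.lookup t x < k"
    using x(1) u(1) by (auto simp: bounded_exponents_def intro: less_le_trans)
  moreover have "Poly_Mapping.lookup s x \<ge> 1" using x(1) u(3)[of x] by simp
  ultimately show "\<exists>x\<in>linear_vars e k t. Poly_Mapping.lookup s x \<ge> 1"
    by (auto simp: linear_vars_def)
next
  assume "\<exists>x\<in>linear_vars e k t. Poly_Mapping.lookup s x \<ge> 1"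
  then obtain x y where xy: "Poly_Mapping.lookup s x \<ge> 1" "Poly_Mapping.lookup t x < k"
      "e x < e y" "Poly_Mapping.lookup t y > 0"
    by (auto simp: linear_vars_def)
  have ne: "x \<noteq> y" using xy(3) by auto
  \<comment> \<open>The required generator is \<open>t\<close> with one factor \<open>y\<close>
    traded for \<open>x\<close>.\<close>
  define u where "u = t + Poly_Mapping.single x 1 - Poly_Mapping.single y 1"
  have u: "Poly_Mapping.lookup u z = (if z = x then Poly_Mapping.lookup t x + 1
      else if z = y then Poly_Mapping.lookup t y - 1 else Poly_Mapping.lookup t z)" for z
    using ne by (auto simp: u_def lookup_add lookup_minus lookup_single when_def)
  have "u + Poly_Mapping.single y 1 = t + Poly_Mapping.single x 1"
    using ne xy(4) by (intro poly_mapping_eqI) (auto simp: lookup_add u lookup_single when_def)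
  then have "mdeg u + 1 = mdeg t + 1" using mdeg_add mdeg_single by metis
  then have "u \<in> bounded_exponents k" using t u xy(2) by (auto simp: bounded_exponents_def intro: le_trans[OF diff_le_self])
  moreover have "lex_greater e u t" unfolding lex_greater_def
    using u xy(3) by (intro exI[of _ x]) auto
  moreover have "\<forall>z. Poly_Mapping.lookup u z \<le> Poly_Mapping.lookup (t + s) z"
    using u xy(1) by (auto simp: lookup_add)
  ultimately show "\<exists>u\<in>{u \<in> bounded_exponents k. lex_greater e u t}. \<exists>v. t + s = u + v"
    unfolding exponent_le_iff by blast
qed

definition power_rank :: "('n::finite \<Rightarrow> nat) \<Rightarrow> nat \<Rightarrow> nat \<Rightarrow> nat"
  where "power_rank e k i = (if i = 0 then 1
    else \<Sum>t\<in>bounded_exponents k. card (linear_vars e k t) choose (i - 1))"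

lemma linear_resolution_power:
  fixes e :: "'n::finite \<Rightarrow> nat"
  assumes e: "inj e"
  shows "\<exists>d. linear_resolution (monomial_ideal (bounded_exponents k) :: ('n, 'k::comm_ring_1) mpoly set)
    (2 * k) (power_rank e k) d"
proof -
  define R where "R V i = (if i = 0 then 1 else \<Sum>t\<in>V. card (linear_vars e k t) choose (i - 1))"
    for V :: "('n \<Rightarrow>\<^sub>0 nat) set" and i :: nat
  define P where "P V \<longleftrightarrow> (\<exists>d. linear_resolution (monomial_ideal V :: ('n, 'k) mpoly set) (2 * k) (R V) d)" for V
  have "P (bounded_exponents k)"
  proof (rule linear_order_induct[where L = "lex_greater e"])
    have "R {} = (\<lambda>i. if i = 0 then 1 else 0)" by (auto simp: R_def)
    then show "P {}" using linear_resolution_zero unfolding P_def by (auto simp: monomial_ideal_empty)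
  next
    fix t :: "'n \<Rightarrow>\<^sub>0 nat" assume t: "t \<in> bounded_exponents k"
    let ?U = "{s \<in> bounded_exponents k. lex_greater e s t}"
    assume "P ?U"
    moreover have deg: "mdeg t = 2 * k" using t by (simp add: bounded_exponents_def)
    ultimately obtain d where d: "linear_resolution (monomial_ideal ?U :: ('n, 'k) mpoly set) (mdeg t) (R ?U) d"
      by (auto simp: P_def)
    let ?W = "(\<lambda>x. Poly_Mapping.single x (1::nat)) ` linear_vars e k t"
    obtain d' where d': "linear_resolution (monomial_ideal ?W :: ('n, 'k) mpoly set) 1
        (\<lambda>i. card (linear_vars e k t) choose i) d'"
      using linear_resolution_koszul[of "linear_vars e k t"] by auto
    have colon: "(\<exists>u\<in>?U. \<exists>v. t + s = u + v) \<longleftrightarrow> (\<exists>u\<in>?W. \<exists>v. s = u + v)" for s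
      unfolding linear_quotients[OF e t] var_divides_iff ..
    have "(\<lambda>i. R ?U i + (if i = 0 then 0 else card (linear_vars e k t) choose (i - 1))) = R (insert t ?U)"
    proof -
      have "finite ?U" "t \<notin> ?U"
        using finite_bounded_exponents[of k] lex_greater_irrefl[of e t] by auto
      then show ?thesis by (simp add: R_def fun_eq_iff)
    qed
    then show "P (insert t ?U)"
      using linear_resolution_insert_monomial[OF d d' colon] unfolding P_def deg by simp
  next
    show "lex_greater e s u" if "lex_greater e s t" "lex_greater e t u" for s t u :: "'n \<Rightarrow>\<^sub>0 nat"
      using lex_greater_trans[OF e] that by blast
  next
    show "lex_greater e s t \<or> lex_greater e t s" if "s \<noteq> t" for s t :: "'n \<Rightarrow>\<^sub>0 nat"
      using lex_greater_total[OF e that] .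
  qed (auto simp: finite_bounded_exponents lex_greater_irrefl)
  moreover have "R (bounded_exponents k) = power_rank e k" by (auto simp: R_def power_rank_def)
  ultimately show ?thesis by (simp add: P_def)
qed

text \<open>The last variable of the numbering is never linear, there being no later one to trade.
  This bounds the length of the resolution by the number of variables.\<close>

lemma card_linear_vars_less:
  fixes e :: "'n::finite \<Rightarrow> nat"
  assumes e: "inj e" and t: "t \<in> bounded_exponents k"
  shows "card (linear_vars e k t) < CARD('n)"
proof -
  have "\<exists>x. x \<notin> linear_vars e k t"
  proof -
    obtain x where "\<And>y. e y \<le> e x"
      using Max_in[of "range e"] Max_ge[of "range e"] by fastforce
    then have "x \<notin> linear_vars e k t" by (auto simp: linear_vars_def leD)
    then show ?thesis ..
  qed
  then have "linear_vars e k t \<subset> UNIV" by blast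
  then show ?thesis by (intro psubset_card_mono) auto
qed

section \<open>Minimality and the Betti numbers\<close>

lemma minimal_resolution_power:
  fixes e :: "'n::finite \<Rightarrow> nat"
  assumes e: "inj e" and k: "k \<ge> 1"
  shows "\<exists>a d. minimal_graded_free_resolution
    (ideal_power squarefree_deg2_ideal k :: ('n, 'k::field) mpoly set) (power_rank e k) a d"
proof -
  obtain d where d: "linear_resolution (monomial_ideal (bounded_exponents k) :: ('n, 'k) mpoly set)
      (2 * k) (power_rank e k) d"
    using linear_resolution_power[OF e] by blast
  then have res: "resolves (monomial_ideal (bounded_exponents k)) (power_rank e k) d"
    by (simp add: linear_resolution_def)
  define a where "a i p = (if i = 0 then 0 else int (2 * k + i - 1))" for i p :: nat
  have zero: "power_rank e k i = 0" if "i > CARD('n)" for i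
  proof -
    have "card (linear_vars e k t) choose (i - 1) = 0" if "t \<in> bounded_exponents k" for t
      using card_linear_vars_less[OF e that] \<open>i > CARD('n)\<close> by (intro binomial_eq_0) simp
    then show ?thesis using that by (simp add: power_rank_def)
  qed
  have hom: "homogeneous (a (Suc i) q - a i p) (d (Suc i) $$ (p, q)) \<and>
      d (Suc i) $$ (p, q) \<in> maximal_homogeneous_ideal"
    if "p < power_rank e k i" "q < power_rank e k (Suc i)" for i p q
  proof -
    define m where "m = (if i = 0 then 2 * k else 1)"
    have "homog_mat m (d (Suc i))"
      using d by (cases i) (auto simp: m_def linear_resolution_def)
    then have h: "homogeneous (int m) (d (Suc i) $$ (p, q))"
      using that resolves_carrier[OF res, of i] by (auto simp: homog_mat_def)
    \<comment> \<open>With \<open>k = 0\<close> the matrix \<open>d 1\<close> could contain units;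
      positive degree rules out constant terms.\<close>
    have "m > 0" using k by (simp add: m_def)
    then have "0 \<notin> Poly_Mapping.keys (d (Suc i) $$ (p, q))"
      using h by (auto simp: homogeneous_def mdeg_def)
    then have "d (Suc i) $$ (p, q) \<in> maximal_homogeneous_ideal"
      by (simp add: maximal_homogeneous_ideal_eq in_keys_iff)
    moreover have "a (Suc i) q - a i p = int m" by (auto simp: a_def m_def)
    ultimately show ?thesis using h by simp
  qed
  show ?thesis
    unfolding minimal_graded_free_resolution_def ideal_power_squarefree_deg2
    using res zero hom by (intro exI[of _ a] exI[of _ d]) (auto simp: resolves_def a_def)
qed

lemma betti_power:
  fixes e :: "'n::finite \<Rightarrow> nat"
  assumes e: "inj e" and k: "k \<ge> 1"
  shows "betti (ideal_power squarefree_deg2_ideal k :: ('n, 'k::field) mpoly set) i = power_rank e k i"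
  unfolding betti_def
proof (rule the_equality)
  show "\<exists>r a d. minimal_graded_free_resolution
      (ideal_power squarefree_deg2_ideal k :: ('n, 'k) mpoly set) r a d \<and> r i = power_rank e k i"
    using minimal_resolution_power[OF e k] by blast
next
  let ?J = "ideal_power squarefree_deg2_ideal k :: ('n, 'k) mpoly set"
  \<comment> \<open>Stated for any two minimal resolutions, to be applied in both
    directions.\<close>
  have le: "r i \<le> s i" if "minimal_graded_free_resolution ?J r a d"
    "minimal_graded_free_resolution ?J s b d'" for r s a b d d'
  proof -
    have "resolves ?J r d" "resolves ?J s d'"
      using that by (auto simp: minimal_graded_free_resolution_def resolves_def)
    moreover have "Poly_Mapping.lookup (d (Suc j) $$ (p, q)) 0 = 0" if "p < r j" "q < r (Suc j)" for j p q
      using \<open>minimal_graded_free_resolution ?J r a d\<close> that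
      by (auto simp: minimal_graded_free_resolution_def maximal_homogeneous_ideal_eq)
    ultimately show ?thesis by (rule rank_le[OF constant_term_hom])
  qed
  fix b assume "\<exists>r a d. minimal_graded_free_resolution ?J r a d \<and> r i = b"
  then show "b = power_rank e k i"
    using minimal_resolution_power[OF e k] le by (blast intro: le_antisym)
qed

section \<open>Counting the generators\<close>

abbreviation expo :: "('n \<Rightarrow>\<^sub>0 nat) \<Rightarrow> 'n \<Rightarrow> nat" where "expo \<equiv> Poly_Mapping.lookup"

definition exponents_on :: "'n::finite set \<Rightarrow> nat \<Rightarrow> ('n \<Rightarrow>\<^sub>0 nat) set"
  where "exponents_on A m = {t. mdeg t = m \<and> (\<forall>x. x \<notin> A \<longrightarrow> expo t x = 0)}"

lemma finite_exponents_on: "finite (exponents_on A m)"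
  using finite_mdeg[of m] by (rule rev_finite_subset) (auto simp: exponents_on_def)

text \<open>Stars and bars: an exponent vector supported on \<open>A\<close> is the multiplicity
  function of a multiset. Truncated subtraction gives the right values for empty \<open>A\<close>
  too, namely 1 if \<open>m = 0\<close> and 0 otherwise.\<close>

lemma card_exponents_on: "card (exponents_on A m) = (card A + m - 1) choose m"
proof -
  let ?f = "\<lambda>X. Abs_poly_mapping (count X) :: 'a \<Rightarrow>\<^sub>0 nat"
  let ?g = "\<lambda>t :: 'a \<Rightarrow>\<^sub>0 nat. Abs_multiset (expo t)"
  have f: "expo (?f X) = count X" for X :: "'a multiset" by (simp add: Abs_poly_mapping_inverse)
  have g: "count (?g t) = expo t" for t :: "'a \<Rightarrow>\<^sub>0 nat" by (simp add: count_Abs_multiset)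
  have size: "size X = (\<Sum>x\<in>UNIV. count X x)" for X :: "'a multiset"
    unfolding size_multiset_overloaded_eq by (intro sum.mono_neutral_left) (auto simp: count_eq_zero_iff)
  have "bij_betw ?f (multisets_of_size A m) (exponents_on A m)"
  proof (rule bij_betw_byWitness[where f' = ?g])
    show "\<forall>X\<in>multisets_of_size A m. ?g (?f X) = X" by (simp add: f count_inverse)
    show "\<forall>t\<in>exponents_on A m. ?f (?g t) = t" by (simp add: g lookup_inverse)
    show "?f ` multisets_of_size A m \<subseteq> exponents_on A m"
    proof
      fix t assume "t \<in> ?f ` multisets_of_size A m"
      then obtain X where X: "t = ?f X" "set_mset X \<subseteq> A" "size X = m"
        by (auto simp: multisets_of_size_def)
      have "mdeg t = m" using X(3) size[of X] by (simp add: X(1) f mdeg_def)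
      moreover have "expo t x = 0" if "x \<notin> A" for x
        using that X(2) by (auto simp: X(1) f count_eq_zero_iff)
      ultimately show "t \<in> exponents_on A m" by (simp add: exponents_on_def)
    qed
    show "?g ` exponents_on A m \<subseteq> multisets_of_size A m"
    proof
      fix X assume "X \<in> ?g ` exponents_on A m"
      then obtain t where t: "X = ?g t" "mdeg t = m" "\<And>x. x \<notin> A \<Longrightarrow> expo t x = 0"
        by (auto simp: exponents_on_def)
      have "size X = m" using t(2) by (simp add: size t(1) g mdeg_def)
      moreover have "set_mset X \<subseteq> A"
      proof
        fix x assume "x \<in># X"
        then have "expo t x > 0" by (simp add: t(1) g flip: count_greater_zero_iff)
        then show "x \<in> A" using t(3)[of x] by auto
      qed
      ultimately show "X \<in> multisets_of_size A m" by (simp add: multisets_of_size_def)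
    qed
  qed
  from bij_betw_same_card[OF this] show ?thesis by (simp add: card_multisets_of_size)
qed

lemma two_exponents_le_mdeg:
  fixes t :: "'n::finite \<Rightarrow>\<^sub>0 nat"
  assumes "x \<noteq> y"
  shows "expo t x + expo t y \<le> mdeg t"
  using sum_mono2[of UNIV "{x, y}" "expo t"] assms by (simp add: mdeg_def)

lemma three_exponents_le_mdeg:
  fixes t :: "'n::finite \<Rightarrow>\<^sub>0 nat"
  assumes "x \<noteq> y" "y \<noteq> z" "x \<noteq> z"
  shows "expo t x + expo t y + expo t z \<le> mdeg t"
  using sum_mono2[of UNIV "{x, y, z}" "expo t"] assms by (simp add: mdeg_def)

text \<open>In degree \<open>2k\<close> at most one exponent can exceed \<open>k\<close>, so the
  sets of violators are disjoint and inclusion-exclusion stops after its first correction. It serves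
  both for all variables and for an initial segment of them.\<close>

lemma card_bounded_on:
  fixes A :: "'n::finite set"
  shows
  "card (exponents_on A (2 * k)) = card {t \<in> exponents_on A (2 * k). \<forall>x. expo t x \<le> k} +
    (\<Sum>x\<in>A. card {t \<in> exponents_on A (2 * k). expo t x > k})"
proof -
  let ?E = "\<lambda>x. {t \<in> exponents_on A (2 * k). expo t x > k}"
  have fin: "finite (?E x)" for x by (simp add: finite_exponents_on)
  have "exponents_on A (2 * k) = {t \<in> exponents_on A (2 * k). \<forall>x. expo t x \<le> k} \<union> (\<Union>x\<in>A. ?E x)"
  proof (intro equalityI subsetI)
    fix t assume t: "t \<in> exponents_on A (2 * k)"
    show "t \<in> {t \<in> exponents_on A (2 * k). \<forall>x. expo t x \<le> k} \<union> (\<Union>x\<in>A. ?E x)"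
    proof (cases "\<forall>x. expo t x \<le> k")
      case False
      then obtain x where x: "expo t x > k" by (auto simp: not_le)
      moreover have "x \<in> A" using t x by (auto simp: exponents_on_def)
      ultimately show ?thesis using t by auto
    qed (use t in auto)
  qed auto
  then have "card (exponents_on A (2 * k)) =
      card ({t \<in> exponents_on A (2 * k). \<forall>x. expo t x \<le> k} \<union> (\<Union>x\<in>A. ?E x))" by (rule arg_cong)
  also have "\<dots> = card {t \<in> exponents_on A (2 * k). \<forall>x. expo t x \<le> k} + card (\<Union>x\<in>A. ?E x)"
  proof (rule card_Un_disjoint)
    show "{t \<in> exponents_on A (2 * k). \<forall>x. expo t x \<le> k} \<inter> (\<Union>x\<in>A. ?E x) = {}"
      by (blast dest: leD)
  qed (simp_all add: finite_exponents_on)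
  also have "card (\<Union>x\<in>A. ?E x) = (\<Sum>x\<in>A. card (?E x))"
  proof (intro card_UN_disjoint ballI impI)
    fix x y :: 'n assume "x \<noteq> y"
    show "?E x \<inter> ?E y = {}"
    proof (rule ccontr)
      assume "?E x \<inter> ?E y \<noteq> {}"
      then obtain t where "mdeg t = 2 * k" "expo t x > k" "expo t y > k" by (auto simp: exponents_on_def)
      then show False using two_exponents_le_mdeg[OF \<open>x \<noteq> y\<close>, of t] by simp
    qed
  qed (auto intro: fin)
  finally show ?thesis .
qed

text \<open>Dividing by \<open>x\<close> to the power \<open>k + 1\<close> leaves an arbitrary
  monomial of degree \<open>2k - (k + 1) = k - 1\<close>, a true subtraction because
  \<open>k \<ge> 1\<close>.\<close>

lemma card_large_exponent:
  assumes x: "x \<in> A" and k: "k \<ge> 1"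
  shows "card {t \<in> exponents_on A (2 * k). expo t x > k} = card (exponents_on A (k - 1))"
proof -
  let ?u = "Poly_Mapping.single x (k + 1)"
  have sub: "t - ?u + ?u = t" if "expo t x > k" for t
    using that by (intro poly_mapping_eqI) (auto simp: lookup_add lookup_minus lookup_single when_def)
  have "bij_betw (\<lambda>t. t - ?u) {t \<in> exponents_on A (2 * k). expo t x > k} (exponents_on A (k - 1))"
  proof (rule bij_betw_byWitness[where f' = "\<lambda>t. t + ?u"])
    show "(\<lambda>t. t - ?u) ` {t \<in> exponents_on A (2 * k). expo t x > k} \<subseteq> exponents_on A (k - 1)"
    proof
      fix s assume "s \<in> (\<lambda>t. t - ?u) ` {t \<in> exponents_on A (2 * k). expo t x > k}"
      then obtain t where t: "s = t - ?u" "t \<in> exponents_on A (2 * k)" "expo t x > k" by auto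
      then have "mdeg s + (k + 1) = 2 * k"
        using sub[OF t(3)] mdeg_add[of s ?u] by (simp add: exponents_on_def)
      then show "s \<in> exponents_on A (k - 1)"
        using t by (auto simp: exponents_on_def lookup_minus)
    qed
    show "(\<lambda>t. t + ?u) ` exponents_on A (k - 1) \<subseteq> {t \<in> exponents_on A (2 * k). expo t x > k}"
      using x k by (auto simp: exponents_on_def mdeg_add lookup_add lookup_single when_def)
  qed (use sub in auto)
  then show ?thesis by (rule bij_betw_same_card)
qed

text \<open>The formula for \<beta> at index 1, written additively to avoid subtraction on naturals.
  The product removes, for each variable, the monomials in which its exponent exceeds
  \<open>k\<close>; binomial symmetry turns the lower index from the degree into
  \<open>n - 1\<close>.\<close>

lemma card_bounded_exponents:
  assumes k: "k \<ge> 1"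
  shows "card (bounded_exponents k :: ('n::finite \<Rightarrow>\<^sub>0 nat) set) + CARD('n) * ((CARD('n) + k - 2) choose (CARD('n) - 1))
    = (CARD('n) + 2 * k - 1) choose (CARD('n) - 1)"
proof -
  let ?n = "CARD('n)"
  have n: "?n \<ge> 1" by (simp add: Suc_leI)
  have symm: "(?n + m - 1) choose m = (?n + m - 1) choose (?n - 1)" for m
  proof -
    have "m \<le> ?n + m - 1" "?n + m - 1 - m = ?n - 1" using n by linarith+
    then show ?thesis using binomial_symmetric by metis
  qed
  have b: "{t \<in> exponents_on (UNIV :: 'n set) (2 * k). \<forall>x. expo t x \<le> k} = bounded_exponents k"
    by (auto simp: exponents_on_def bounded_exponents_def)
  have c: "card {t \<in> exponents_on (UNIV :: 'n set) (2 * k). expo t x > k} = (?n + k - 2) choose (?n - 1)" for x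
  proof -
    have "?n + (k - 1) - 1 = ?n + k - 2" using k by simp
    then show ?thesis
      using card_large_exponent[of x UNIV k] k symm[of "k - 1"] by (simp only: card_exponents_on UNIV_I)
  qed
  have "(?n + 2 * k - 1) choose (?n - 1) = card (exponents_on (UNIV :: 'n set) (2 * k))"
    by (simp only: card_exponents_on symm)
  also have "\<dots> = card (bounded_exponents k :: ('n \<Rightarrow>\<^sub>0 nat) set) +
      (\<Sum>x\<in>UNIV. card {t \<in> exponents_on (UNIV :: 'n set) (2 * k). expo t x > k})"
    using card_bounded_on[of "UNIV :: 'n set" k] by (simp only: b)
  also have "(\<Sum>x\<in>UNIV. card {t \<in> exponents_on (UNIV :: 'n set) (2 * k). expo t x > k}) =
      ?n * ((?n + k - 2) choose (?n - 1))"
    by (simp only: c sum_constant of_nat_id)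
  finally show ?thesis by (rule sym)
qed

text \<open>Lowering the exponent of \<open>x\<close> to \<open>k\<close> and moving the excess to the new variable \<open>y\<close> is a bijection.\<close>

lemma card_move_excess:
  assumes x: "x \<in> A" and y: "y \<notin> A"
  shows "card {t \<in> exponents_on A (2 * k). expo t x > k} =
    card {t \<in> exponents_on (insert y A) (2 * k). expo t x = k \<and> expo t y > 0}"
proof -
  define f where "f t = t + Poly_Mapping.single y (expo t x - k) - Poly_Mapping.single x (expo t x - k)" for t :: "'a \<Rightarrow>\<^sub>0 nat"
  define g where "g t = t + Poly_Mapping.single x (expo t y) - Poly_Mapping.single y (expo t y)" for t :: "'a \<Rightarrow>\<^sub>0 nat"
  have ne: "x \<noteq> y" using x y by auto
  have ef: "expo (f t) z = (if z = x then k else if z = y then expo t x - k else expo t z)"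
    if "t \<in> {t \<in> exponents_on A (2 * k). expo t x > k}" for t z
    using that ne y by (auto simp: f_def exponents_on_def lookup_add lookup_minus lookup_single when_def)
  have eg: "expo (g t) z = (if z = x then k + expo t y else if z = y then 0 else expo t z)"
    if "expo t x = k" for t z
    using that ne by (auto simp: g_def lookup_add lookup_minus lookup_single when_def)
  have mf: "mdeg (f t) = mdeg t" if "t \<in> {t \<in> exponents_on A (2 * k). expo t x > k}" for t
  proof -
    have "f t + Poly_Mapping.single x (expo t x - k) = t + Poly_Mapping.single y (expo t x - k)"
      using that ne y by (intro poly_mapping_eqI)
        (auto simp: lookup_add ef[OF that] lookup_single when_def exponents_on_def)
    from arg_cong[OF this, of mdeg] show ?thesis
      unfolding mdeg_add mdeg_single by (rule add_right_imp_eq)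
  qed
  have mg: "mdeg (g t) = mdeg t" if "expo t x = k" for t
  proof -
    have "g t + Poly_Mapping.single y (expo t y) = t + Poly_Mapping.single x (expo t y)"
      using that ne by (intro poly_mapping_eqI) (auto simp: lookup_add eg[OF that] lookup_single when_def)
    from arg_cong[OF this, of mdeg] show ?thesis
      unfolding mdeg_add mdeg_single by (rule add_right_imp_eq)
  qed
  have "bij_betw f {t \<in> exponents_on A (2 * k). expo t x > k}
    {t \<in> exponents_on (insert y A) (2 * k). expo t x = k \<and> expo t y > 0}"
  proof (rule bij_betw_byWitness[where f' = g])
    show "\<forall>t\<in>{t \<in> exponents_on A (2 * k). expo t x > k}. g (f t) = t"
    proof
      fix t assume t: "t \<in> {t \<in> exponents_on A (2 * k). expo t x > k}"
      show "g (f t) = t"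
        using eg[of "f t"] ef[OF t] t y ne by (intro poly_mapping_eqI) (auto simp: exponents_on_def)
    qed
    show "f ` {t \<in> exponents_on A (2 * k). expo t x > k} \<subseteq>
        {t \<in> exponents_on (insert y A) (2 * k). expo t x = k \<and> expo t y > 0}"
    proof
      fix s assume "s \<in> f ` {t \<in> exponents_on A (2 * k). expo t x > k}"
      then obtain t where t: "s = f t" "t \<in> {t \<in> exponents_on A (2 * k). expo t x > k}" by blast
      show "s \<in> {t \<in> exponents_on (insert y A) (2 * k). expo t x = k \<and> expo t y > 0}"
        using mf[OF t(2)] ef[OF t(2)] t(2) x ne unfolding t(1) by (auto simp: exponents_on_def)
    qed
    show G: "g ` {t \<in> exponents_on (insert y A) (2 * k). expo t x = k \<and> expo t y > 0} \<subseteq>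
        {t \<in> exponents_on A (2 * k). expo t x > k}"
    proof
      fix s assume "s \<in> g ` {t \<in> exponents_on (insert y A) (2 * k). expo t x = k \<and> expo t y > 0}"
      then obtain t where t: "s = g t" "t \<in> exponents_on (insert y A) (2 * k)" "expo t x = k" "expo t y > 0" by blast
      show "s \<in> {t \<in> exponents_on A (2 * k). expo t x > k}"
        using mg[OF t(3)] eg[OF t(3)] t(2,4) x ne unfolding t(1) by (auto simp: exponents_on_def)
    qed
    show "\<forall>t\<in>{t \<in> exponents_on (insert y A) (2 * k). expo t x = k \<and> expo t y > 0}. f (g t) = t"
    proof
      fix t assume t: "t \<in> {t \<in> exponents_on (insert y A) (2 * k). expo t x = k \<and> expo t y > 0}"
      then have tx: "expo t x = k" by auto
      have "g t \<in> {t \<in> exponents_on A (2 * k). expo t x > k}" using t G by blast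
      from ef[OF this] show "f (g t) = t"
        using eg[OF tx] tx ne by (intro poly_mapping_eqI) auto
    qed
  qed
  then show ?thesis by (rule bij_betw_same_card)
qed

section \<open>Counting generators by their number of linear variables\<close>

lemma card_initial_segment:
  assumes e: "bij_betw e UNIV {0..<N}" and m: "m \<le> (N::nat)"
  shows "card {x. e x < m} = m"
proof -
  have "e ` {x. e x < m} = range e \<inter> {0..<m}" by auto
  also have "\<dots> = {0..<m}" using e m by (auto simp: bij_betw_def)
  finally have "card (e ` {x. e x < m}) = m" by simp
  moreover have "inj_on e {x. e x < m}" using e by (auto simp: bij_betw_def inj_on_def)
  ultimately show ?thesis by (simp add: card_image)
qed

text \<open>If \<open>z\<close> is the last variable occurring in \<open>t\<close>, the linear
  variables are those before \<open>z\<close> with exponent below \<open>k\<close>. At most one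
  earlier variable has exponent \<open>k\<close>, since two would use up the degree
  \<open>2k\<close> and leave nothing for \<open>z\<close>. Hence their number is \<open>e z\<close>
  or \<open>e z - 1\<close>; it is at most \<open>j\<close> if \<open>e z \<le> j\<close>, or if
  \<open>e z = j + 1\<close> and an earlier exponent equals \<open>k\<close>.\<close>

lemma card_linear_vars_le_iff:
  fixes e :: "'n::finite \<Rightarrow> nat"
  assumes e: "bij_betw e UNIV {0..<CARD('n)}" and k: "k \<ge> 1" and t: "t \<in> bounded_exponents k"
    and y: "e y = Suc j"
  shows "card (linear_vars e k t) \<le> j \<longleftrightarrow> t \<in> exponents_on {x. e x \<le> j} (2 * k) \<or>
    (\<exists>x. e x \<le> j \<and> t \<in> exponents_on (insert y {x. e x \<le> j}) (2 * k) \<and> expo t x = k \<and> expo t y > 0)"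
proof -
  have inj: "inj e" using e by (simp add: bij_betw_def)
  have bound: "e x < CARD('n)" for x using e by (auto simp: bij_betw_def)
  have deg: "mdeg t = 2 * k" and le: "\<And>x. expo t x \<le> k" using t by (auto simp: bounded_exponents_def)
  have pos: "{x. expo t x > 0} \<noteq> {}"
  proof
    assume "{x. expo t x > 0} = {}"
    then have "mdeg t = 0" unfolding mdeg_def by (intro sum.neutral) auto
    then show False using deg k by simp
  qed
  have "\<exists>z. expo t z > 0 \<and> (\<forall>x. expo t x > 0 \<longrightarrow> e x \<le> e z)"
  proof -
    have "Max (e ` {x. expo t x > 0}) \<in> e ` {x. expo t x > 0}" using pos by (intro Max_in) auto
    then obtain z where "expo t z > 0" "e z = Max (e ` {x. expo t x > 0})" by auto
    then show ?thesis by (intro exI[of _ z]) auto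
  qed
  then obtain z where z: "expo t z > 0" "\<And>x. expo t x > 0 \<Longrightarrow> e x \<le> e z" by blast
  let ?K = "{x. e x < e z \<and> expo t x = k}"
  have lv: "linear_vars e k t = {x. e x < e z} - ?K"
  proof -
    have "(\<exists>y. e x < e y \<and> 0 < expo t y) \<longleftrightarrow> e x < e z" for x
      using z by (meson less_le_trans)
    moreover have "expo t x < k \<longleftrightarrow> expo t x \<noteq> k" for x using le[of x] by auto
    ultimately show ?thesis by (auto simp: linear_vars_def)
  qed
  have K1: "u = v" if "u \<in> ?K" "v \<in> ?K" for u v
  proof (rule ccontr)
    assume "u \<noteq> v"
    then have "expo t u + expo t v + expo t z \<le> mdeg t" using that by (intro three_exponents_le_mdeg) auto
    then show False using that z(1) deg by simp
  qed
  have card_lv: "card (linear_vars e k t) + card ?K = e z"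
  proof -
    have sub: "?K \<subseteq> {x. e x < e z}" by auto
    then show ?thesis
      using card_initial_segment[OF e, of "e z"] bound[of z] card_Diff_subset[OF finite sub]
        card_mono[OF finite sub] unfolding lv by linarith
  qed
  show ?thesis
  proof (cases "e z \<le> j")
    case True
    then have "t \<in> exponents_on {x. e x \<le> j} (2 * k)"
      using deg z(2) by (fastforce simp: exponents_on_def)
    then show ?thesis using card_lv True by auto
  next
    case False
    then have notin: "t \<notin> exponents_on {x. e x \<le> j} (2 * k)" using z(1) by (auto simp: exponents_on_def)
    show ?thesis
    proof
      assume "card (linear_vars e k t) \<le> j"
      then have "card ?K \<noteq> 0" using card_lv False by linarith
      then obtain x where x: "x \<in> ?K" by (metis card.empty equals0I)
      then have "?K = {x}" using K1 by blast
      then have "e z = Suc j" using card_lv False \<open>card (linear_vars e k t) \<le> j\<close> by simp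
      then have "e z = e y" using y by simp
      then have "z = y" by (rule injD[OF inj])
      have "t \<in> exponents_on (insert y {x. e x \<le> j}) (2 * k)"
      proof -
        have "expo t w = 0" if "w \<notin> insert y {x. e x \<le> j}" for w
        proof (rule ccontr)
          assume "expo t w \<noteq> 0"
          then have "e w \<le> Suc j" using z(2)[of w] \<open>e z = Suc j\<close> by simp
          then have "e w = e y" using that y by auto
          then have "w = y" by (rule injD[OF inj])
          then show False using that by simp
        qed
        then show ?thesis using deg by (simp add: exponents_on_def)
      qed
      then show "t \<in> exponents_on {x. e x \<le> j} (2 * k) \<or>
        (\<exists>x. e x \<le> j \<and> t \<in> exponents_on (insert y {x. e x \<le> j}) (2 * k) \<and> expo t x = k \<and> expo t y > 0)"
        using x \<open>e z = Suc j\<close> \<open>z = y\<close> z(1) by (auto simp: less_Suc_eq_le)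
    next
      assume "t \<in> exponents_on {x. e x \<le> j} (2 * k) \<or>
        (\<exists>x. e x \<le> j \<and> t \<in> exponents_on (insert y {x. e x \<le> j}) (2 * k) \<and> expo t x = k \<and> expo t y > 0)"
      then obtain x where x: "e x \<le> j" "t \<in> exponents_on (insert y {x. e x \<le> j}) (2 * k)" "expo t x = k"
        using notin by auto
      have "z \<in> insert y {x. e x \<le> j}" using x(2) z(1) by (auto simp: exponents_on_def)
      then have ez: "e z = Suc j" using False y by auto
      then have "x \<in> ?K" using x by simp
      then have "?K \<noteq> {}" by blast
      then have "card ?K \<noteq> 0" using card_gt_0_iff[of ?K] by simp
      then show "card (linear_vars e k t) \<le> j" using card_lv ez by linarith
    qed
  qed
qed

text \<open>
  The exponents in question correspond bijectively to all monomials of degree \<open>2k\<close> in the first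
  \<open>j + 1\<close> variables: such a monomial has at most one exponent above \<open>k\<close>, and moving its excess to
  the next variable gives exactly the remaining ones.
\<close>

lemma card_few_linear_vars:
  fixes e :: "'n::finite \<Rightarrow> nat"
  assumes e: "bij_betw e UNIV {0..<CARD('n)}" and k: "k \<ge> 1" and j: "Suc j < CARD('n)"
  shows "card {t \<in> bounded_exponents k. card (linear_vars e k t) \<le> j} = (2 * k + j) choose j"
proof -
  \<comment> \<open>The excess goes to the variable numbered \<open>j + 1\<close>, which exists by
    \<open>j\<close>.\<close>
  have "Suc j \<in> range e" using e j by (simp add: bij_betw_def)
  then obtain y where y: "e y = Suc j" by (metis imageE)
  let ?A = "{x. e x \<le> j}"
  have cA: "card ?A = Suc j"
    using card_initial_segment[OF e, of "Suc j"] j by (simp add: less_Suc_eq_le)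
  have yA: "y \<notin> ?A" using y by simp
  let ?B = "{t \<in> exponents_on ?A (2 * k). \<forall>x. expo t x \<le> k}"
  let ?E = "\<lambda>x. {t \<in> exponents_on (insert y ?A) (2 * k). expo t x = k \<and> expo t y > 0}"
  \<comment> \<open>The exponent \<open>k\<close> of \<open>x\<close> leaves degree \<open>k\<close>
    for all other variables together.\<close>
  have E_bounded: "t \<in> bounded_exponents k" if "t \<in> ?E x" "x \<in> ?A" for t x
  proof -
    have "expo t z \<le> k" for z
      using two_exponents_le_mdeg[of x z t] that by (cases "z = x") (auto simp: exponents_on_def)
    then show ?thesis using that by (auto simp: exponents_on_def bounded_exponents_def)
  qed
  have "{t \<in> bounded_exponents k. card (linear_vars e k t) \<le> j} = ?B \<union> (\<Union>x\<in>?A. ?E x)"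
  proof (intro equalityI subsetI)
    fix t assume "t \<in> {t \<in> bounded_exponents k. card (linear_vars e k t) \<le> j}"
    then show "t \<in> ?B \<union> (\<Union>x\<in>?A. ?E x)"
      using card_linear_vars_le_iff[OF e k _ y, of t] by (auto simp: bounded_exponents_def)
  next
    fix t assume t: "t \<in> ?B \<union> (\<Union>x\<in>?A. ?E x)"
    then have "t \<in> bounded_exponents k"
      using E_bounded by (auto simp: exponents_on_def bounded_exponents_def)
    then show "t \<in> {t \<in> bounded_exponents k. card (linear_vars e k t) \<le> j}"
      using t card_linear_vars_le_iff[OF e k _ y, of t] by auto
  qed
  then have "card {t \<in> bounded_exponents k. card (linear_vars e k t) \<le> j} = card (?B \<union> (\<Union>x\<in>?A. ?E x))"
    by (rule arg_cong)
  also have "\<dots> = card ?B + card (\<Union>x\<in>?A. ?E x)"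
  proof (rule card_Un_disjoint)
    show "?B \<inter> (\<Union>x\<in>?A. ?E x) = {}" using yA by (auto simp: exponents_on_def)
  qed (simp_all add: finite_exponents_on)
  also have "card (\<Union>x\<in>?A. ?E x) = (\<Sum>x\<in>?A. card (?E x))"
  proof (intro card_UN_disjoint ballI impI)
    fix x x' assume x: "x \<in> ?A" "x' \<in> ?A" "x \<noteq> x'"
    \<comment> \<open>Two exponents equal to \<open>k\<close> exhaust the degree, so
      \<open>y\<close> could not occur.\<close>
    show "?E x \<inter> ?E x' = {}"
    proof (rule ccontr)
      assume "?E x \<inter> ?E x' \<noteq> {}"
      then obtain t where "mdeg t = 2 * k" "expo t x = k" "expo t x' = k" "expo t y > 0"
        by (auto simp: exponents_on_def)
      then show False using three_exponents_le_mdeg[of x x' y t] x yA by auto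
    qed
  qed (simp_all add: finite_exponents_on)
  also have "\<dots> = (\<Sum>x\<in>?A. card {t \<in> exponents_on ?A (2 * k). expo t x > k})"
    using card_move_excess[OF _ yA] by (intro sum.cong refl) simp
  also have "card ?B + \<dots> = card (exponents_on ?A (2 * k))"
    by (rule card_bounded_on[symmetric])
  also have "\<dots> = (2 * k + j) choose j"
    using binomial_symmetric[of j "2 * k + j"] by (simp add: card_exponents_on cA add.commute)
  finally show ?thesis .
qed

text \<open>After binomial(q, i + 1) is expanded as a sum over \<open>j < q\<close> and the sums are
  exchanged, \<open>t\<close> matters only through whether its number of linear variables exceeds
  \<open>j\<close>. That number is below \<open>n\<close>, so \<open>j\<close> stops at
  \<open>n - 2\<close>: this is the origin of the matrix of binomials and of its size.\<close>

lemma power_rank_sum: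
  fixes e :: "'n::finite \<Rightarrow> nat"
  assumes e: "bij_betw e UNIV {0..<CARD('n)}" and k: "k \<ge> 1"
  shows "int (power_rank e k (i + 2)) =
    (\<Sum>j<CARD('n) - 1. int (j choose i) * (int (card (bounded_exponents k :: ('n \<Rightarrow>\<^sub>0 nat) set)) - int ((2 * k + j) choose j)))"
proof -
  let ?T = "bounded_exponents k :: ('n \<Rightarrow>\<^sub>0 nat) set" and ?q = "\<lambda>t. card (linear_vars e k t)"
  have inj: "inj e" using e by (simp add: bij_betw_def)
  have count: "int (card {t \<in> ?T. j < ?q t}) = int (card ?T) - int ((2 * k + j) choose j)"
    if "j < CARD('n) - 1" for j
  proof -
    have "card ?T = card ({t \<in> ?T. j < ?q t} \<union> {t \<in> ?T. ?q t \<le> j})"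
      by (rule arg_cong[of _ _ card]) auto
    also have "\<dots> = card {t \<in> ?T. j < ?q t} + card {t \<in> ?T. ?q t \<le> j}"
      by (intro card_Un_disjoint) (auto simp: finite_bounded_exponents)
    finally show ?thesis using card_few_linear_vars[OF e k, of j] that by simp
  qed
  have hockey: "q choose Suc i = (\<Sum>j<q. j choose i)" for q
    by (induction q) auto
  have "power_rank e k (i + 2) = (\<Sum>t\<in>?T. \<Sum>j<?q t. j choose i)"
    by (simp add: power_rank_def hockey)
  also have "\<dots> = (\<Sum>t\<in>?T. \<Sum>j<CARD('n) - 1. if j < ?q t then j choose i else 0)"
  proof (rule sum.cong[OF refl])
    fix t assume "t \<in> ?T"
    then have "{j \<in> {..<CARD('n) - 1}. j < ?q t} = {..<?q t}"
      using card_linear_vars_less[OF inj, of t k] by auto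
    then show "(\<Sum>j<?q t. j choose i) = (\<Sum>j<CARD('n) - 1. if j < ?q t then j choose i else 0)"
      by (simp only: finite_lessThan flip: sum.inter_filter)
  qed
  also have "\<dots> = (\<Sum>j<CARD('n) - 1. \<Sum>t\<in>?T. if j < ?q t then j choose i else 0)"
    by (rule sum.swap)
  also have "\<dots> = (\<Sum>j<CARD('n) - 1. (j choose i) * card {t \<in> ?T. j < ?q t})"
    by (intro sum.cong refl) (simp add: finite_bounded_exponents mult.commute flip: sum.inter_filter)
  finally have "int (power_rank e k (i + 2)) =
      (\<Sum>j<CARD('n) - 1. int (j choose i) * int (card {t \<in> ?T. j < ?q t}))"
    by (simp only: of_nat_sum of_nat_mult)
  also have "\<dots> = (\<Sum>j<CARD('n) - 1. int (j choose i) * (int (card ?T) - int ((2 * k + j) choose j)))"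
    by (intro sum.cong refl) (simp only: count lessThan_iff)
  finally show ?thesis .
qed

theorem corollary2p3:
  fixes I :: "('n::finite, 'k::field) mpoly set" and n k :: nat and \<beta> :: "nat \<Rightarrow> int"
  assumes n: "n = CARD('n)" and k: "k \<ge> 1"
    and I: "I = squarefree_deg2_ideal"
    and \<beta>: "\<And>i. \<beta> i = int (betti (ideal_power I k) i)"
  shows "\<beta> 1 = int ((n + 2 * k - 1) choose (n - 1)) - int n * int ((n + k - 2) choose (n - 1))
    \<and> vec (n - 1) (\<lambda>i. \<beta> (i + 2)) =
        mat (n - 1) (n - 1) (\<lambda>(i, j). int (j choose i)) *\<^sub>v
        vec (n - 1) (\<lambda>i. \<beta> 1 - int ((2 * k + i) choose i))"
proof -
  \<comment> \<open>Any numbering of the variables serves, as the Betti numbers do not depend on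
    it.\<close>
  obtain e :: "'n \<Rightarrow> nat" where e: "bij_betw e UNIV {0..<CARD('n)}"
    using ex_bij_betw_finite_nat[of "UNIV :: 'n set"] by auto
  then have inj: "inj e" by (simp add: bij_betw_def)
  have rank: "\<beta> i = int (power_rank e k i)" for i
    using betti_power[OF inj k] by (simp add: \<beta> I)
  have \<beta>1: "\<beta> 1 = int (card (bounded_exponents k :: ('n \<Rightarrow>\<^sub>0 nat) set))"
    by (simp add: rank power_rank_def)
  have "\<beta> 1 + int (n * ((n + k - 2) choose (n - 1))) = int ((n + 2 * k - 1) choose (n - 1))"
    unfolding \<beta>1 n using card_bounded_exponents[OF k, where 'n = 'n] by (simp flip: of_nat_add of_nat_mult)
  moreover have "vec (n - 1) (\<lambda>i. \<beta> (i + 2)) =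
      mat (n - 1) (n - 1) (\<lambda>(i, j). int (j choose i)) *\<^sub>v
      vec (n - 1) (\<lambda>i. \<beta> 1 - int ((2 * k + i) choose i))"
    unfolding \<beta>1
    by (rule eq_vecI) (auto simp: rank power_rank_sum[OF e k, unfolded add_2_eq_Suc'] n scalar_prod_def lessThan_atLeast0)
  ultimately show ?thesis by simp
qed

end
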